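(* Let $k$ be an algebraically closed field of characteristic zero. Let $X\subset\mathbb{P}^N$ be a nondegenerate reduced scheme with a defining ideal $I\subset R=k[x_0,\ldots,x_N]$, let $q\in X$ be any (possibly singular) point, with coordinates chosen so that $q=(1:0:\cdots:0)$, and let $S=k[x_1,\ldots,x_N]$. For the inner projection $X_q\subset\mathbb{P}^{N-1}$ we have: (a) $\beta_{0,2}(J)=\beta_{0,2}(I)-\beta_{0,1}(K_1(I))$, where $J=I\cap S$ is the $x_0$-elimination ideal of $I$ and $K_1(I)\subset S$ is the first partial elimination ideal of $I$. (b) Furthermore, if $I$ is quadratic, i.e. generated by forms of degree 2 (so $X$ is quadratic), then $\beta_{0,2}(J)=\beta_{0,2}(I)-N+\dim T_qX$. In particular, in case $I=I_X$ (the saturated ideal of $X$), this reads $$h^0(\mathbb{P}^{N-1},\mathcal{I}_{X_q}(2))=h^0(\mathbb{P}^{N},\mathcal{I}_{X}(2))-N+\dim T_qX.$$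
   Context: A homogeneous ideal $I\subset R$ is a defining ideal of $X$ if its sheafification is the ideal sheaf $\mathcal{I}_X$. $X$ is nondegenerate if it is contained in no hyperplane. $X_q=\overline{\pi_q(X\setminus\{q\})}$, where $\pi_q$ is the linear projection from $q$, with scheme structure given by $J=I\cap S$. Betti numbers: $\beta_{i,j}(I)=\dim_k\mathrm{Tor}^R_i(I,k)_{i+j}$ for the $R$-ideal $I$, and $\beta_{i,j}(\cdot)=\dim_k\mathrm{Tor}^S_i(\cdot,k)_{i+j}$ for the $S$-ideals $J$ and $K_1(I)$. $T_qX$ is the Zariski tangent space of $X$ at $q$. Partial elimination ideal: let $d_0(f)$ be the degree of $f$ in $x_0$. Each homogeneous $f\in I$ with $d_0(f)\le 1$ is uniquely $f=x_0\bar f+g$ with $\bar f,g\in S$; $K_1(I)$ is the ideal of $S$ generated by all such $\bar f$. *)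

theory Defs
  imports
    "HOL-Library.Poly_Mapping"
    "HOL-Library.Function_Algebras"
    "HOL-Computational_Algebra.Computational_Algebra"
begin

section \<open>Polynomials\<close>

text \<open>
  All polynomial rings are taken inside \<open>k[x\<^sub>0, x\<^sub>1, \<dots>]\<close>; for a set \<open>V\<close> of indices, \<open>polys V\<close>
  is the subring \<open>k[x\<^sub>i : i \<in> V]\<close>. So \<open>R = polys {0..N}\<close> and \<open>S = polys {1..N}\<close>, with \<open>S \<subseteq> R\<close>.
\<close>

type_synonym 'k mpol = "(nat \<Rightarrow>\<^sub>0 nat) \<Rightarrow>\<^sub>0 'k"

definition Const :: "'k::field \<Rightarrow> 'k mpol" where
  "Const c = Poly_Mapping.single 0 c"

definition Var :: "nat \<Rightarrow> 'k::field mpol" where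
  "Var i = Poly_Mapping.single (Poly_Mapping.single i 1) 1"

definition polys :: "nat set \<Rightarrow> 'k::field mpol set" where
  "polys V = {p. \<forall>m\<in>Poly_Mapping.keys p. Poly_Mapping.keys m \<subseteq> V}"

definition mdeg :: "(nat \<Rightarrow>\<^sub>0 nat) \<Rightarrow> nat" where
  "mdeg m = (\<Sum>i\<in>Poly_Mapping.keys m. Poly_Mapping.lookup m i)"

text \<open>Forms of degree \<open>d\<close>; the zero polynomial is a form of every degree.\<close>

definition form :: "nat \<Rightarrow> 'k::field mpol \<Rightarrow> bool" where
  "form d p \<longleftrightarrow> (\<forall>m\<in>Poly_Mapping.keys p. mdeg m = d)"

definition hcomp :: "nat \<Rightarrow> 'k::field mpol \<Rightarrow> 'k mpol" where
  "hcomp d p = (\<Sum>m\<in>{m \<in> Poly_Mapping.keys p. mdeg m = d}.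
      Poly_Mapping.single m (Poly_Mapping.lookup p m))"

definition const_coeff :: "'k::field mpol \<Rightarrow> 'k" where
  "const_coeff p = Poly_Mapping.lookup p 0"

text \<open>Substitution of \<open>\<sigma> i\<close> for \<open>x\<^sub>i\<close>, the coefficients being mapped by \<open>h\<close>.\<close>

definition subst_poly :: "('k \<Rightarrow> 'a) \<Rightarrow> (nat \<Rightarrow> 'a) \<Rightarrow> 'k::field mpol \<Rightarrow> 'a::comm_ring_1" where
  "subst_poly h \<sigma> p = (\<Sum>m\<in>Poly_Mapping.keys p.
      h (Poly_Mapping.lookup p m) * (\<Prod>j\<in>Poly_Mapping.keys m. \<sigma> j ^ Poly_Mapping.lookup m j))"

definition eval_at :: "(nat \<Rightarrow> 'k) \<Rightarrow> 'k::field mpol \<Rightarrow> 'k" where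
  "eval_at a p = subst_poly (\<lambda>c. c) a p"

definition dehom :: "nat \<Rightarrow> 'k::field mpol \<Rightarrow> 'k mpol" where
  "dehom i p = subst_poly Const (Var(i := 1)) p"

definition ideal_in :: "nat set \<Rightarrow> 'k::field mpol set \<Rightarrow> bool" where
  "ideal_in V I \<longleftrightarrow> I \<subseteq> polys V \<and> 0 \<in> I \<and> (\<forall>f\<in>I. \<forall>g\<in>I. f + g \<in> I) \<and>
     (\<forall>r\<in>polys V. \<forall>f\<in>I. r * f \<in> I)"

definition homogeneous_ideal :: "nat set \<Rightarrow> 'k::field mpol set \<Rightarrow> bool" where
  "homogeneous_ideal V I \<longleftrightarrow> ideal_in V I \<and> (\<forall>f\<in>I. \<forall>d. hcomp d f \<in> I)"

definition radical_ideal :: "nat set \<Rightarrow> 'k::field mpol set \<Rightarrow> bool" where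
  "radical_ideal V I \<longleftrightarrow> ideal_in V I \<and> (\<forall>f\<in>polys V. \<forall>n. f ^ n \<in> I \<longrightarrow> f \<in> I)"

definition quadratic_ideal :: "nat set \<Rightarrow> 'k::field mpol set \<Rightarrow> bool" where
  "quadratic_ideal V I \<longleftrightarrow> (\<exists>G \<subseteq> polys V. (\<forall>g\<in>G. form 2 g) \<and> I = ideal_in V hull G)"


section \<open>Vector spaces over the ground field\<close>

definition pm_scale :: "'r::comm_ring_1 \<Rightarrow> ('a \<Rightarrow>\<^sub>0 'r) \<Rightarrow> ('a \<Rightarrow>\<^sub>0 'r)" where
  "pm_scale c f = Poly_Mapping.map (\<lambda>x. c * x) f"

definition fn_scale :: "'k::field \<Rightarrow> ('a \<Rightarrow> 'k) \<Rightarrow> ('a \<Rightarrow> 'k)" where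
  "fn_scale c \<phi> = (\<lambda>x. c * \<phi> x)"

definition fract_scale :: "'k::field \<Rightarrow> 'k mpol fract \<Rightarrow> 'k mpol fract" where
  "fract_scale c z = Fract (Const c) 1 * z"

lemma lookup_pm_scale: "Poly_Mapping.lookup (pm_scale c f) x = c * Poly_Mapping.lookup f x"
  by (simp add: pm_scale_def Poly_Mapping.map.rep_eq when_def)

global_interpretation pm: vector_space "pm_scale :: 'k::field \<Rightarrow> ('a \<Rightarrow>\<^sub>0 'k) \<Rightarrow> ('a \<Rightarrow>\<^sub>0 'k)"
  by standard (auto intro!: poly_mapping_eqI simp: lookup_pm_scale lookup_add algebra_simps)

global_interpretation fn: vector_space "fn_scale :: 'k::field \<Rightarrow> ('a \<Rightarrow> 'k) \<Rightarrow> ('a \<Rightarrow> 'k)"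
  by standard (auto simp: fn_scale_def algebra_simps fun_eq_iff)

global_interpretation fr: vector_space "fract_scale :: 'k::field \<Rightarrow> 'k mpol fract \<Rightarrow> 'k mpol fract"
proof
  show "fract_scale (a + b) x = fract_scale a x + fract_scale b x" for a b :: 'k and x
  proof -
    have "Fract (Const (a + b)) 1 = Fract (Const a) 1 + Fract (Const b) 1"
      by (simp add: Const_def single_add)
    then show ?thesis by (simp only: fract_scale_def distrib_right)
  qed
  show "fract_scale a (fract_scale b x) = fract_scale (a * b) x" for a b :: 'k and x
  proof -
    have "Fract (Const (a * b)) 1 = Fract (Const a) 1 * Fract (Const b) 1"
      by (simp add: Const_def mult_single)
    then show ?thesis by (simp add: fract_scale_def mult.assoc)
  qed
  show "fract_scale (1::'k) x = x" for x
    by (simp add: fract_scale_def Const_def One_fract_def[symmetric])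
qed (simp add: fract_scale_def algebra_simps)


section \<open>Tor and graded Betti numbers\<close>

text \<open>
  A graded free complex \<open>\<dots> \<rightarrow> F\<^sub>1 \<rightarrow> F\<^sub>0 \<rightarrow> I\<close> over \<open>polys V\<close>, given by matrices. \<open>F\<^sub>i\<close> is free on the
  set \<open>gens F i\<close> with \<open>b\<close> in degree \<open>gdeg F i b\<close>; \<open>diff F i b\<close> is the image in \<open>F\<^sub>i\<close> of the generator
  \<open>b\<close> of \<open>F\<^sub>i\<^sub>+\<^sub>1\<close>, and \<open>aug F b\<close> the image in \<open>I\<close> of the generator \<open>b\<close> of \<open>F\<^sub>0\<close>.
\<close>

record (overloaded) 'k free_complex =
  gens :: "nat \<Rightarrow> nat set"
  gdeg :: "nat \<Rightarrow> nat \<Rightarrow> nat"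
  diff :: "nat \<Rightarrow> nat \<Rightarrow> (nat \<Rightarrow>\<^sub>0 'k mpol)"
  aug :: "nat \<Rightarrow> 'k mpol"

definition free_module :: "nat set \<Rightarrow> nat set \<Rightarrow> (nat \<Rightarrow>\<^sub>0 'k::field mpol) set" where
  "free_module V B =
     {f. Poly_Mapping.keys f \<subseteq> B \<and> (\<forall>b. Poly_Mapping.lookup f b \<in> polys V)}"

definition homogeneous_elt :: "(nat \<Rightarrow> nat) \<Rightarrow> nat \<Rightarrow> (nat \<Rightarrow>\<^sub>0 'k::field mpol) \<Rightarrow> bool" where
  "homogeneous_elt g d f \<longleftrightarrow>
     (\<forall>b\<in>Poly_Mapping.keys f. g b \<le> d \<and> form (d - g b) (Poly_Mapping.lookup f b))"

definition lin_ext :: "('b \<Rightarrow> ('c \<Rightarrow>\<^sub>0 'r)) \<Rightarrow> ('b \<Rightarrow>\<^sub>0 'r::comm_ring_1) \<Rightarrow> ('c \<Rightarrow>\<^sub>0 'r)" where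
  "lin_ext \<phi> f = (\<Sum>b\<in>Poly_Mapping.keys f. pm_scale (Poly_Mapping.lookup f b) (\<phi> b))"

definition aug_map :: "'k::field free_complex \<Rightarrow> (nat \<Rightarrow>\<^sub>0 'k mpol) \<Rightarrow> 'k mpol" where
  "aug_map F f = (\<Sum>b\<in>Poly_Mapping.keys f. Poly_Mapping.lookup f b * aug F b)"

text \<open>Finitely many generators in each degree keep all graded pieces finite-dimensional.\<close>

definition graded_free_resolution ::
    "nat set \<Rightarrow> 'k::field mpol set \<Rightarrow> 'k free_complex \<Rightarrow> bool" where
  "graded_free_resolution V I F \<longleftrightarrow>
     (\<forall>i d. finite {b \<in> gens F i. gdeg F i b = d}) \<and>
     (\<forall>b\<in>gens F 0. aug F b \<in> I \<and> form (gdeg F 0 b) (aug F b)) \<and>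
     (\<forall>i. \<forall>b\<in>gens F (Suc i). diff F i b \<in> free_module V (gens F i) \<and>
        homogeneous_elt (gdeg F i) (gdeg F (Suc i) b) (diff F i b)) \<and>
     aug_map F ` free_module V (gens F 0) = I \<and>
     {f \<in> free_module V (gens F 0). aug_map F f = 0} =
       lin_ext (diff F 0) ` free_module V (gens F 1) \<and>
     (\<forall>i. {f \<in> free_module V (gens F (Suc i)). lin_ext (diff F i) f = 0} =
       lin_ext (diff F (Suc i)) ` free_module V (gens F (Suc (Suc i))))"

text \<open>
  The complex \<open>F \<otimes> k\<close>, where \<open>k = polys V / (x\<^sub>i : i \<in> V)\<close>: it has \<open>F\<^sub>i \<otimes> k = k\<^bsup>(gens F i)\<^esup>\<close>, and its
  matrices are the residues of the matrices of \<open>F\<close>, i.e. the constant coefficients.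
\<close>

definition tensor_strand :: "'k::field free_complex \<Rightarrow> nat \<Rightarrow> nat \<Rightarrow> (nat \<Rightarrow>\<^sub>0 'k) set" where
  "tensor_strand F i j = {f. Poly_Mapping.keys f \<subseteq> {b \<in> gens F i. gdeg F i b = j}}"

definition tensor_diff :: "'k::field free_complex \<Rightarrow> nat \<Rightarrow> (nat \<Rightarrow>\<^sub>0 'k) \<Rightarrow> (nat \<Rightarrow>\<^sub>0 'k)" where
  "tensor_diff F i = lin_ext (\<lambda>b. Poly_Mapping.map const_coeff (diff F i b))"

definition tensor_cycles :: "'k::field free_complex \<Rightarrow> nat \<Rightarrow> nat \<Rightarrow> (nat \<Rightarrow>\<^sub>0 'k) set" where
  "tensor_cycles F i j =
     {f \<in> tensor_strand F i j. case i of 0 \<Rightarrow> True | Suc i' \<Rightarrow> tensor_diff F i' f = 0}"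

definition tensor_boundaries :: "'k::field free_complex \<Rightarrow> nat \<Rightarrow> nat \<Rightarrow> (nat \<Rightarrow>\<^sub>0 'k) set" where
  "tensor_boundaries F i j = tensor_diff F i ` tensor_strand F (Suc i) j"

text \<open>
  \<open>tor_dim V I i j\<close> is the dimension of \<open>Tor\<^sub>i(I, k)\<^sub>j = H\<^sub>i(F \<otimes> k)\<^sub>j\<close> over \<open>polys V\<close>; as usual it does
  not depend on the chosen resolution \<open>F\<close> of \<open>I\<close>.
\<close>

definition tor_dim :: "nat set \<Rightarrow> 'k::field mpol set \<Rightarrow> nat \<Rightarrow> nat \<Rightarrow> nat" where
  "tor_dim V I i j = (let F = (SOME F. graded_free_resolution V I F) in
     pm.dim (tensor_cycles F i j) - pm.dim (tensor_boundaries F i j))"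

definition betti :: "nat set \<Rightarrow> nat \<Rightarrow> nat \<Rightarrow> 'k::field mpol set \<Rightarrow> nat" where
  "betti V i j I = tor_dim V I i (i + j)"


section \<open>Closed subschemes of projective space\<close>

text \<open>
  \<open>V\<close> indexes the homogeneous coordinates, so \<open>P\<^sup>N\<close> is the case \<open>V = {0..N}\<close> and \<open>P\<^sup>N\<^sup>-\<^sup>1\<close>, with
  coordinates \<open>x\<^sub>1, \<dots>, x\<^sub>N\<close>, the case \<open>V = {1..N}\<close>. The chart \<open>U\<^sub>i = (x\<^sub>i \<noteq> 0)\<close> is the spectrum of
  \<open>polys (V - {i})\<close>, where the variable \<open>x\<^sub>j\<close> stands for \<open>x\<^sub>j / x\<^sub>i\<close>.

  A closed subscheme is given by its quasi-coherent ideal sheaf, that is by an ideal \<open>X i\<close> on each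
  chart \<open>U\<^sub>i\<close>, such that \<open>X i\<close> and \<open>X j\<close> agree on \<open>U\<^sub>i \<inter> U\<^sub>j\<close>. For a form \<open>f\<close>, the function
  \<open>f(x / x\<^sub>i)\<close> belongs to the localisation of \<open>X i\<close> on \<open>U\<^sub>i \<inter> U\<^sub>j\<close> iff some \<open>x\<^sub>j\<^sup>m f(x / x\<^sub>i)\<close> is in \<open>X i\<close>,
  and on \<open>U\<^sub>i \<inter> U\<^sub>j\<close> the functions \<open>f(x / x\<^sub>i)\<close> and \<open>f(x / x\<^sub>j)\<close> differ by a unit.
\<close>

type_synonym 'k subscheme = "nat \<Rightarrow> 'k mpol set"

definition closed_subscheme :: "nat set \<Rightarrow> 'k::field subscheme \<Rightarrow> bool" where
  "closed_subscheme V X \<longleftrightarrow>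
     (\<forall>i\<in>V. ideal_in (V - {i}) (X i)) \<and>
     (\<forall>i\<in>V. \<forall>j\<in>V. \<forall>f\<in>polys V. (\<exists>d. form d f) \<longrightarrow>
        ((\<exists>m. Var j ^ m * dehom i f \<in> X i) \<longleftrightarrow> (\<exists>m. Var i ^ m * dehom j f \<in> X j)))"

definition reduced :: "nat set \<Rightarrow> 'k::field subscheme \<Rightarrow> bool" where
  "reduced V X \<longleftrightarrow> (\<forall>i\<in>V. radical_ideal (V - {i}) (X i))"

text \<open>On \<open>U\<^sub>i\<close>, the sheafification of \<open>I\<close> is the degree-zero part \<open>{f / x\<^sub>i\<^sup>d : f \<in> I\<^sub>d}\<close> of \<open>I[1/x\<^sub>i]\<close>.\<close>

definition sheafify :: "'k::field mpol set \<Rightarrow> 'k subscheme" where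
  "sheafify I i = {dehom i f | f. f \<in> I \<and> (\<exists>d. form d f)}"

definition defining_ideal :: "nat set \<Rightarrow> 'k::field subscheme \<Rightarrow> 'k mpol set \<Rightarrow> bool" where
  "defining_ideal V X I \<longleftrightarrow> homogeneous_ideal V I \<and> (\<forall>i\<in>V. sheafify I i = X i)"

definition saturated_ideal :: "nat set \<Rightarrow> 'k::field subscheme \<Rightarrow> 'k mpol set" where
  "saturated_ideal V X = {f \<in> polys V. \<forall>d. \<forall>i\<in>V. dehom i (hcomp d f) \<in> X i}"

definition contained_in :: "nat set \<Rightarrow> 'k::field subscheme \<Rightarrow> 'k subscheme \<Rightarrow> bool" where
  "contained_in V X Y \<longleftrightarrow> (\<forall>i\<in>V. Y i \<subseteq> X i)"

definition hyperplane :: "nat set \<Rightarrow> 'k::field mpol \<Rightarrow> 'k subscheme" where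
  "hyperplane V l = sheafify (ideal_in V hull {l})"

definition nondegenerate :: "nat set \<Rightarrow> 'k::field subscheme \<Rightarrow> bool" where
  "nondegenerate V X \<longleftrightarrow>
     (\<forall>l\<in>polys V. form 1 l \<and> l \<noteq> 0 \<longrightarrow> \<not> contained_in V X (hyperplane V l))"

text \<open>Closed points are given by homogeneous coordinates \<open>a\<close>.\<close>

definition mem_scheme :: "nat set \<Rightarrow> (nat \<Rightarrow> 'k) \<Rightarrow> 'k::field subscheme \<Rightarrow> bool" where
  "mem_scheme V a X \<longleftrightarrow> (\<exists>i\<in>V. a i \<noteq> 0) \<and>
     (\<forall>i\<in>V. a i \<noteq> 0 \<longrightarrow> (\<forall>f\<in>X i. eval_at (\<lambda>j. a j / a i) f = 0))"

definition coord_point :: "nat \<Rightarrow> nat \<Rightarrow> 'k::field" where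
  "coord_point i = (\<lambda>j. if j = i then 1 else 0)"

text \<open>
  The Zariski tangent space \<open>(\<mm> / \<mm>\<^sup>2)\<^sup>*\<close> at the point \<open>a\<close> of the affine scheme defined by the ideal \<open>A\<close>
  of \<open>polys W\<close>: linear functionals on the maximal ideal \<open>M\<close> of \<open>a\<close> in \<open>polys W\<close> which vanish on
  \<open>M\<^sup>2 + A\<close>, extended by zero outside of \<open>M\<close>.
\<close>

definition max_ideal :: "nat set \<Rightarrow> (nat \<Rightarrow> 'k) \<Rightarrow> 'k::field mpol set" where
  "max_ideal W a = {f \<in> polys W. eval_at a f = 0}"

definition affine_tangent_space ::
    "nat set \<Rightarrow> 'k::field mpol set \<Rightarrow> (nat \<Rightarrow> 'k) \<Rightarrow> ('k mpol \<Rightarrow> 'k) set" where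
  "affine_tangent_space W A a = {\<phi>. let M = max_ideal W a in
     (\<forall>f. f \<notin> M \<longrightarrow> \<phi> f = 0) \<and>
     (\<forall>f\<in>M. \<forall>g\<in>M. \<phi> (f + g) = \<phi> f + \<phi> g) \<and>
     (\<forall>c. \<forall>f\<in>M. \<phi> (Const c * f) = c * \<phi> f) \<and>
     (\<forall>f\<in>M. \<forall>g\<in>M. \<phi> (f * g) = 0) \<and>
     (\<forall>f\<in>A. \<phi> f = 0)}"

text \<open>Computed in the chart \<open>U\<^sub>i\<close>, which has to contain \<open>a\<close>.\<close>

definition tangent_space ::
    "nat set \<Rightarrow> 'k::field subscheme \<Rightarrow> nat \<Rightarrow> (nat \<Rightarrow> 'k) \<Rightarrow> ('k mpol \<Rightarrow> 'k) set" where
  "tangent_space V X i a = affine_tangent_space (V - {i}) (X i) (\<lambda>j. a j / a i)"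

text \<open>
  Sections of the twisted ideal sheaf \<open>\<I>\<^sub>X(d)\<close>. Over \<open>U\<^sub>i\<close> they are the fractions
  \<open>f / x\<^sub>i\<^sup>m = x\<^sub>i\<^sup>d f(x / x\<^sub>i)\<close> with \<open>f\<close> a form of degree \<open>d + m\<close> and \<open>f(x / x\<^sub>i) \<in> X i\<close>. As projective
  space is integral, all of them lie in the field of fractions of \<open>polys V\<close>, and global sections
  form the intersection over the charts.
\<close>

definition chart_sections ::
    "nat set \<Rightarrow> 'k::field subscheme \<Rightarrow> nat \<Rightarrow> nat \<Rightarrow> 'k mpol fract set" where
  "chart_sections V X d i =
     {Fract f (Var i ^ m) | f m. f \<in> polys V \<and> form (d + m) f \<and> dehom i f \<in> X i}"

definition global_sections :: "nat set \<Rightarrow> 'k::field subscheme \<Rightarrow> nat \<Rightarrow> 'k mpol fract set" where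
  "global_sections V X d = (\<Inter>i\<in>V. chart_sections V X d i)"

definition h0 :: "nat set \<Rightarrow> 'k::field subscheme \<Rightarrow> nat \<Rightarrow> nat" where
  "h0 V X d = fr.dim (global_sections V X d)"


section \<open>Elimination ideals and inner projection\<close>

definition elim_ideal :: "nat \<Rightarrow> 'k::field mpol set \<Rightarrow> 'k mpol set" where
  "elim_ideal N I = I \<inter> polys {1..N}"

text \<open>A polynomial has degree at most 1 in \<open>x\<^sub>0\<close> iff it is \<open>x\<^sub>0 f' + g\<close> with \<open>f', g \<in> S\<close>.\<close>

definition partial_elim_ideal1 :: "nat \<Rightarrow> 'k::field mpol set \<Rightarrow> 'k mpol set" where
  "partial_elim_ideal1 N I = ideal_in {1..N} hull
     {f' \<in> polys {1..N}. \<exists>g\<in>polys {1..N}. Var 0 * f' + g \<in> I \<and> (\<exists>d. form d (Var 0 * f' + g))}"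

text \<open>
  The inner projection from \<open>q = (1 : 0 : \<dots> : 0)\<close>, with the scheme structure given by the
  elimination ideal. Its underlying scheme is the closure of \<open>\<pi>\<^sub>q(X - {q})\<close>, see
  \<open>inner_projection_eq_closure\<close> below.
\<close>

definition inner_projection :: "nat \<Rightarrow> 'k::field mpol set \<Rightarrow> 'k subscheme" where
  "inner_projection N I = sheafify (elim_ideal N I)"

text \<open>
  The scheme-theoretic closure of \<open>\<pi>\<^sub>q(X - {q})\<close>: for \<open>i \<ge> 1\<close> the preimage of \<open>U\<^sub>i\<close> in \<open>X - {q}\<close> is
  \<open>X \<inter> U\<^sub>i\<close>, and a function on \<open>U\<^sub>i\<close> vanishes on the image iff it lies in \<open>X i\<close> as a
  polynomial not involving \<open>x\<^sub>0\<close>.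
\<close>

definition projection_closure :: "nat \<Rightarrow> 'k::field subscheme \<Rightarrow> 'k subscheme" where
  "projection_closure N X i = X i \<inter> polys ({1..N} - {i})"

definition drop_var :: "nat \<Rightarrow> (nat \<Rightarrow>\<^sub>0 nat) \<Rightarrow> (nat \<Rightarrow>\<^sub>0 nat)" where
  "drop_var i m = Poly_Mapping.update i 0 m"

lemma lookup_drop_var:
  "Poly_Mapping.lookup (drop_var i m) j = (if j = i then 0 else Poly_Mapping.lookup m j)"
  by (simp add: drop_var_def update.rep_eq)

lemma keys_drop_var: "Poly_Mapping.keys (drop_var i m) = Poly_Mapping.keys m - {i}"
  by (auto simp: in_keys_iff lookup_drop_var split: if_splits)

lemma Var_power: "(Var j :: 'k::field mpol) ^ n = Poly_Mapping.single (Poly_Mapping.single j n) 1"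
proof (induction n)
  case (Suc n)
  then show ?case
    by (simp add: Var_def mult_single flip: single_add)
qed simp

lemma prod_Var:
  assumes "finite A"
  shows "(\<Prod>j\<in>A. (Var j :: 'k::field mpol) ^ e j) =
    Poly_Mapping.single (\<Sum>j\<in>A. Poly_Mapping.single j (e j)) 1"
  using assms by (induction A) (simp_all add: Var_power mult_single)

lemma dehom_eq:
  fixes p :: "'k::field mpol"
  shows "dehom i p = (\<Sum>m\<in>Poly_Mapping.keys p.
    Poly_Mapping.single (drop_var i m) (Poly_Mapping.lookup p m))"
proof -
  have "(\<Prod>j\<in>Poly_Mapping.keys m. ((Var(i := 1)) j :: 'k mpol) ^ Poly_Mapping.lookup m j)
      = Poly_Mapping.single (drop_var i m) 1" for m
  proof -
    have "(\<Prod>j\<in>Poly_Mapping.keys m. ((Var(i := 1)) j :: 'k mpol) ^ Poly_Mapping.lookup m j)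
      = (\<Prod>j\<in>Poly_Mapping.keys m - {i}. Var j ^ Poly_Mapping.lookup m j)"
      by (rule prod.mono_neutral_cong_right) auto
    also have "\<dots> = Poly_Mapping.single
        (\<Sum>j\<in>Poly_Mapping.keys m - {i}. Poly_Mapping.single j (Poly_Mapping.lookup m j)) 1"
      by (rule prod_Var) simp
    also have "(\<Sum>j\<in>Poly_Mapping.keys m - {i}. Poly_Mapping.single j (Poly_Mapping.lookup m j))
        = drop_var i m"
    proof (rule poly_mapping_eqI)
      fix l
      have "Poly_Mapping.lookup
          (\<Sum>j\<in>Poly_Mapping.keys m - {i}. Poly_Mapping.single j (Poly_Mapping.lookup m j)) l
        = (\<Sum>j\<in>Poly_Mapping.keys m - {i}. if j = l then Poly_Mapping.lookup m j else 0)"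
        by (simp add: lookup_sum lookup_single when_def)
      also have "\<dots> = Poly_Mapping.lookup (drop_var i m) l"
        by (auto simp: sum.delta' lookup_drop_var in_keys_iff)
      finally show "Poly_Mapping.lookup
          (\<Sum>j\<in>Poly_Mapping.keys m - {i}. Poly_Mapping.single j (Poly_Mapping.lookup m j)) l
        = Poly_Mapping.lookup (drop_var i m) l" .
    qed
    finally show ?thesis .
  qed
  then show ?thesis
    by (simp add: dehom_def subst_poly_def Const_def mult_single)
qed

lemma mdeg_drop_var: "mdeg m = mdeg (drop_var i m) + Poly_Mapping.lookup m i"
proof -
  have "mdeg (drop_var i m) = (\<Sum>j\<in>Poly_Mapping.keys m - {i}. Poly_Mapping.lookup m j)"
    by (simp add: mdeg_def keys_drop_var lookup_drop_var)
  then show ?thesis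
    by (cases "i \<in> Poly_Mapping.keys m") (auto simp: mdeg_def sum.remove in_keys_iff)
qed

lemma drop_var_inj:
  assumes "mdeg m = mdeg m'" "drop_var i m = drop_var i m'"
  shows "m = m'"
proof (rule poly_mapping_eqI)
  fix j
  have "Poly_Mapping.lookup m i = Poly_Mapping.lookup m' i"
    using mdeg_drop_var[of m i] mdeg_drop_var[of m' i] assms by simp
  then show "Poly_Mapping.lookup m j = Poly_Mapping.lookup m' j"
    using lookup_drop_var[of i m j] lookup_drop_var[of i m' j] assms(2) by (cases "j = i") auto
qed

lemma lookup_dehom_form:
  assumes "form d p" "m \<in> Poly_Mapping.keys p"
  shows "Poly_Mapping.lookup (dehom i p) (drop_var i m) = Poly_Mapping.lookup p m"
proof -
  have *: "drop_var i m' = drop_var i m \<longleftrightarrow> m' = m" if "m' \<in> Poly_Mapping.keys p" for m'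
    using that assms drop_var_inj[of m' m i] by (auto simp: form_def)
  have "Poly_Mapping.lookup (dehom i p) (drop_var i m) =
      (\<Sum>m'\<in>Poly_Mapping.keys p. if m' = m then Poly_Mapping.lookup p m' else 0)"
    unfolding dehom_eq lookup_sum lookup_single when_def by (rule sum.cong) (simp_all add: *)
  then show ?thesis
    using assms(2) by (simp add: sum.delta')
qed

lemma dehom_in_polys_iff:
  assumes "form d p" "i \<in> V"
  shows "dehom i p \<in> polys (V - {i}) \<longleftrightarrow> p \<in> polys V"
proof
  assume *: "dehom i p \<in> polys (V - {i})"
  show "p \<in> polys V"
    unfolding polys_def
  proof (intro CollectI ballI)
    fix m assume m: "m \<in> Poly_Mapping.keys p"
    then have "drop_var i m \<in> Poly_Mapping.keys (dehom i p)"
      using lookup_dehom_form[OF assms(1) m, of i] by (simp add: in_keys_iff)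
    then have "Poly_Mapping.keys m - {i} \<subseteq> V - {i}"
      using * unfolding polys_def keys_drop_var[symmetric] by blast
    then show "Poly_Mapping.keys m \<subseteq> V" using assms(2) by auto
  qed
next
  assume *: "p \<in> polys V"
  have "Poly_Mapping.keys (dehom i p) \<subseteq> drop_var i ` Poly_Mapping.keys p"
    unfolding dehom_eq by (rule order_trans[OF keys_sum]) auto
  then show "dehom i p \<in> polys (V - {i})"
    using * by (fastforce simp: polys_def keys_drop_var)
qed

lemma inner_projection_eq_closure:
  assumes "defining_ideal {0..N} X I" "i \<in> {1..N}"
  shows "inner_projection N I i = projection_closure N X i"
proof -
  have "X i = sheafify I i"
    using assms by (auto simp: defining_ideal_def)
  then show ?thesis
    using dehom_in_polys_iff[where i = i and V = "{1..N}"] assms(2)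
    by (fastforce simp: inner_projection_def projection_closure_def sheafify_def elim_ideal_def)
qed

end

theory Submission
  imports Defs "HOL-Library.Nat_Bijection"
begin

text \<open>
  If \<open>I\<close> has no forms of degree less than \<open>j\<close>, then \<open>\<beta>\<^sub>0\<^sub>,\<^sub>j(I) = dim I\<^sub>j\<close>. Nondegeneracy gives
  \<open>I\<^sub>0 = I\<^sub>1 = 0\<close>, so the Betti numbers of \<open>I\<close>, \<open>J\<close> and \<open>K\<^sub>1(I)\<close> in question are the dimensions of \<open>I\<^sub>2\<close>,
  \<open>J\<^sub>2\<close> and \<open>K\<^sub>1(I)\<^sub>1\<close>. As \<open>q \<in> X\<close>, a quadric of \<open>I\<close> has the form \<open>x\<^sub>0 l + g\<close> with \<open>l, g \<in> S\<close>, and \<open>l\<close> is the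
  linear part at \<open>q\<close> of its dehomogenization. The map \<open>x\<^sub>0 l + g \<mapsto> l\<close> on \<open>I\<^sub>2\<close> has kernel \<open>J\<^sub>2\<close> and
  image \<open>K\<^sub>1(I)\<^sub>1\<close>, which is (a). If \<open>I\<close> is generated by quadrics, this image consists of all the linear
  parts at \<open>q\<close> of equations of \<open>X\<close>, so that it is the annihilator of \<open>T\<^sub>qX\<close> in the \<open>N\<close>-dimensional space \<open>S\<^sub>1\<close>.
  Finally, \<open>J\<close> is saturated in degree 2 if \<open>I\<close> is saturated: if \<open>f \<in> S\<^sub>2\<close> vanishes on \<open>X\<close> away from \<open>q\<close>,
  then \<open>f\<close> vanishes at \<open>q\<close> as well and \<open>X\<close> is reduced, hence \<open>f\<close> vanishes on \<open>X\<close>.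
\<close>

section \<open>Polynomials and their homogeneous components\<close>

lemma poly_mapping_sum_singles:
  fixes p :: "'a \<Rightarrow>\<^sub>0 'b::comm_monoid_add"
  shows "p = (\<Sum>m\<in>Poly_Mapping.keys p. Poly_Mapping.single m (Poly_Mapping.lookup p m))"
  by (rule poly_mapping_eqI) (simp add: lookup_sum lookup_single when_def in_keys_iff)

text \<open>Additive identities need only be checked on single terms; formulas for products then
  follow from two nested inductions.\<close>

lemma poly_mapping_induct [case_names zero single add]:
  fixes p :: "'a \<Rightarrow>\<^sub>0 'b::comm_monoid_add"
  assumes "P 0" "\<And>m c. P (Poly_Mapping.single m c)" "\<And>p q. P p \<Longrightarrow> P q \<Longrightarrow> P (p + q)"
  shows "P p"
proof -
  have "P (\<Sum>m\<in>A. Poly_Mapping.single m (Poly_Mapping.lookup p m))" if "finite A" for A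
    using that by (induction A) (auto intro: assms)
  then show ?thesis
    using poly_mapping_sum_singles[of p] finite_keys by metis
qed

lemma mdeg_superset:
  assumes "finite A" "Poly_Mapping.keys m \<subseteq> A"
  shows "mdeg m = (\<Sum>i\<in>A. Poly_Mapping.lookup m i)"
  unfolding mdeg_def using assms by (intro sum.mono_neutral_left) (auto simp: in_keys_iff)

lemma mdeg_add: "mdeg (m + m') = mdeg m + mdeg m'"
proof -
  let ?A = "Poly_Mapping.keys m \<union> Poly_Mapping.keys m'"
  have "mdeg (m + m') = (\<Sum>i\<in>?A. Poly_Mapping.lookup (m + m') i)"
    by (rule mdeg_superset) (use keys_add[of m m'] in auto)
  moreover have "mdeg m = (\<Sum>i\<in>?A. Poly_Mapping.lookup m i)"
    "mdeg m' = (\<Sum>i\<in>?A. Poly_Mapping.lookup m' i)"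
    by (rule mdeg_superset; simp)+
  ultimately show ?thesis
    by (simp add: lookup_add sum.distrib)
qed

lemma mdeg_0 [simp]: "mdeg 0 = 0"
  by (simp add: mdeg_def)

lemma mdeg_single [simp]: "mdeg (Poly_Mapping.single i n) = n"
  by (simp add: mdeg_def)

lemma mdeg_eq_0_iff: "mdeg m = 0 \<longleftrightarrow> m = 0"
proof
  assume "mdeg m = 0"
  then have "Poly_Mapping.lookup m i = 0" for i
    by (cases "i \<in> Poly_Mapping.keys m") (auto simp: mdeg_def in_keys_iff)
  then show "m = 0" by (intro poly_mapping_eqI) simp
qed simp

lemma mdeg_eq_1_iff: "mdeg m = 1 \<longleftrightarrow> (\<exists>i. m = Poly_Mapping.single i 1)"
proof
  assume *: "mdeg m = 1"
  then have "Poly_Mapping.keys m \<noteq> {}" by (auto simp: mdeg_def)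
  then obtain i where i: "i \<in> Poly_Mapping.keys m" by blast
  then have "Poly_Mapping.lookup m i \<ge> 1" by (simp add: in_keys_iff Suc_le_eq)
  then have "Poly_Mapping.lookup m i = 1" "mdeg (drop_var i m) = 0"
    using mdeg_drop_var[of m i] * by auto
  then have "m = Poly_Mapping.single i 1"
    using lookup_drop_var[of i m]
    by (intro poly_mapping_eqI) (metis lookup_single_eq lookup_single_not_eq lookup_zero mdeg_eq_0_iff)
  then show "\<exists>i. m = Poly_Mapping.single i 1" ..
qed auto

lemma lookup_hcomp: "Poly_Mapping.lookup (hcomp d p) m = (if mdeg m = d then Poly_Mapping.lookup p m else 0)"
  by (auto simp: hcomp_def lookup_sum lookup_single when_def in_keys_iff)

lemma hcomp_0 [simp]: "hcomp d 0 = 0"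
  by (rule poly_mapping_eqI) (simp add: lookup_hcomp)

lemma hcomp_add: "hcomp d (p + q) = hcomp d p + hcomp d q"
  by (rule poly_mapping_eqI) (simp add: lookup_hcomp lookup_add)

lemma hcomp_sum: "hcomp d (\<Sum>a\<in>A. f a) = (\<Sum>a\<in>A. hcomp d (f a))"
  by (rule poly_mapping_eqI) (simp add: lookup_hcomp lookup_sum)

lemma hcomp_scale: "hcomp d (pm_scale c p) = pm_scale c (hcomp d p)"
  by (rule poly_mapping_eqI) (simp add: lookup_hcomp lookup_pm_scale)

lemma hcomp_single: "hcomp d (Poly_Mapping.single m c) = (if mdeg m = d then Poly_Mapping.single m c else 0)"
  by (rule poly_mapping_eqI) (auto simp: lookup_hcomp lookup_single when_def)

lemma keys_hcomp: "Poly_Mapping.keys (hcomp d p) = {m \<in> Poly_Mapping.keys p. mdeg m = d}"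
  by (auto simp: in_keys_iff lookup_hcomp split: if_splits)

text \<open>Both sides are additive in \<open>p\<close> and in \<open>q\<close>. For a product of
  two terms only the summand \<open>i = mdeg m\<close> can survive.\<close>

lemma hcomp_mult: "hcomp d (p * q) = (\<Sum>i\<le>d. hcomp i p * hcomp (d - i) q)"
proof (induction p rule: poly_mapping_induct)
  case (single m c)
  show ?case
  proof (induction q rule: poly_mapping_induct)
    case (single m' c')
    have "(\<Sum>i\<le>d. hcomp i (Poly_Mapping.single m c) * hcomp (d - i) (Poly_Mapping.single m' c'))
      = (\<Sum>i\<le>d. if i = mdeg m \<and> mdeg m' = d - i then Poly_Mapping.single m c * Poly_Mapping.single m' c' else 0)"
      by (rule sum.cong) (auto simp: hcomp_single)
    also have "\<dots> = (\<Sum>i\<le>d. if i = mdeg m then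
        (if mdeg m' = d - mdeg m then Poly_Mapping.single m c * Poly_Mapping.single m' c' else 0) else 0)"
      by (rule sum.cong) auto
    also have "\<dots> = hcomp d (Poly_Mapping.single m c * Poly_Mapping.single m' c')"
      by (auto simp: mult_single hcomp_single mdeg_add)
    finally show ?case ..
  qed (simp_all add: distrib_left hcomp_add sum.distrib)
qed (simp_all add: distrib_right hcomp_add sum.distrib)

lemma form_iff_hcomp: "form d p \<longleftrightarrow> hcomp d p = p"
proof
  assume "form d p"
  then show "hcomp d p = p"
    by (intro poly_mapping_eqI) (auto simp: lookup_hcomp form_def in_keys_iff)
next
  assume "hcomp d p = p"
  then show "form d p" using keys_hcomp[of d p] by (auto simp: form_def)
qed

lemma form_hcomp: "form d (hcomp d p)"
  by (auto simp: form_def keys_hcomp)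

lemma hcomp_form: "form d p \<Longrightarrow> hcomp e p = (if e = d then p else 0)"
  by (rule poly_mapping_eqI) (auto simp: lookup_hcomp form_def in_keys_iff)

lemma form_0 [simp]: "form d 0"
  by (simp add: form_def)

lemma form_add: "form d p \<Longrightarrow> form d q \<Longrightarrow> form d (p + q)"
  by (simp add: form_iff_hcomp hcomp_add)

lemma form_scale: "form d p \<Longrightarrow> form d (pm_scale c p)"
  by (simp add: form_iff_hcomp hcomp_scale)

lemma form_mult:
  assumes "form d p" "form e q"
  shows "form (d + e) (p * q)"
  unfolding form_iff_hcomp hcomp_mult hcomp_form[OF assms(1)] hcomp_form[OF assms(2)]
proof -
  have "(\<Sum>i\<le>d + e. (if i = d then p else 0) * (if d + e - i = e then q else 0))
    = (\<Sum>i\<le>d + e. if i = d then p * q else 0)"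
    by (rule sum.cong) auto
  then show "(\<Sum>i\<le>d + e. (if i = d then p else 0) * (if d + e - i = e then q else 0)) = p * q"
    by simp
qed

text \<open>The degree \<open>e\<close> component of \<open>p * q\<close> is
  \<open>p * hcomp (e - d) q\<close>, and \<open>p\<close> can be cancelled because polynomials form
  a domain.\<close>

lemma form_mult_cancel_left:
  assumes "form d p" "form e (p * q)" "p \<noteq> 0" "d \<le> e"
  shows "form (e - d) q"
proof -
  have "p * q = hcomp e (p * q)" using assms(2) by (simp add: form_iff_hcomp)
  also have "\<dots> = (\<Sum>i\<le>e. if i = d then p * hcomp (e - d) q else 0)"
    unfolding hcomp_mult hcomp_form[OF assms(1)] by (rule sum.cong) auto
  also have "\<dots> = p * hcomp (e - d) q"
    using assms(4) by simp
  finally show ?thesis using assms(3) by (simp add: form_iff_hcomp)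
qed

lemma hcomp_mult_form:
  assumes "form e q"
  shows "hcomp d (p * q) = (if e \<le> d then hcomp (d - e) p * q else 0)"
proof -
  have "hcomp d (p * q) = (\<Sum>i\<le>d. if i = d - e \<and> e \<le> d then hcomp (d - e) p * q else 0)"
    unfolding hcomp_mult hcomp_form[OF assms] by (rule sum.cong) auto
  then show ?thesis by auto
qed

lemma form_single: "mdeg m = d \<Longrightarrow> form d (Poly_Mapping.single m c)"
  by (simp add: form_iff_hcomp hcomp_single)

lemma form_Var: "form 1 (Var i)"
  by (simp add: Var_def form_single)

lemma hcomp_zero_eq: "hcomp 0 p = Const (const_coeff p)"
  by (rule poly_mapping_eqI) (auto simp: lookup_hcomp mdeg_eq_0_iff Const_def const_coeff_def lookup_single when_def)

lemma Const_mult: "Const c * p = pm_scale c p"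
  by (simp add: Const_def pm_scale_def mult_map_scale_conv_mult)

lemma form_0_iff: "form 0 p \<longleftrightarrow> p = Const (const_coeff p)"
  by (metis form_iff_hcomp hcomp_zero_eq)

lemma const_coeff_add: "const_coeff (p + q) = const_coeff p + const_coeff q"
  by (simp add: const_coeff_def lookup_add)

lemma const_coeff_Const [simp]: "const_coeff (Const c) = c"
  by (simp add: const_coeff_def Const_def)

lemma const_coeff_mult: "const_coeff (p * q) = const_coeff p * const_coeff q"
proof -
  have "Const (const_coeff (p * q)) = Const (const_coeff p) * Const (const_coeff q)"
    using hcomp_mult[of 0 p q] by (simp add: hcomp_zero_eq)
  also have "\<dots> = Const (const_coeff p * const_coeff q)"
    by (simp add: Const_def mult_single)
  finally show ?thesis by (metis const_coeff_Const)
qed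

lemma const_coeff_0 [simp]: "const_coeff 0 = 0"
  by (simp add: const_coeff_def)

lemma const_coeff_sum: "const_coeff (\<Sum>a\<in>A. f a) = (\<Sum>a\<in>A. const_coeff (f a))"
  by (simp add: const_coeff_def lookup_sum)

text \<open>The Leibniz rule at the origin. In particular a product of two polynomials without
  constant term has no linear part, and multiplying one such polynomial by \<open>r\<close> only
  scales its linear part.\<close>

lemma hcomp_1_mult:
  "hcomp 1 (p * q) = pm_scale (const_coeff p) (hcomp 1 q) + pm_scale (const_coeff q) (hcomp 1 p)"
proof -
  have "hcomp 1 (p * q) = hcomp 0 p * hcomp 1 q + hcomp 1 p * hcomp 0 q"
    by (simp add: hcomp_mult)
  then show ?thesis
    by (simp add: hcomp_zero_eq Const_mult mult.commute[of "hcomp 1 p"] del: One_nat_def)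
qed

section \<open>Polynomial subrings and their ideals\<close>

lemma polys_0 [simp]: "0 \<in> polys V"
  by (simp add: polys_def)

lemma polys_add: "p \<in> polys V \<Longrightarrow> q \<in> polys V \<Longrightarrow> p + q \<in> polys V"
  unfolding polys_def using keys_add[of p q] by auto

lemma polys_sum: "(\<And>a. a \<in> A \<Longrightarrow> f a \<in> polys V) \<Longrightarrow> (\<Sum>a\<in>A. f a) \<in> polys V"
  by (induction A rule: infinite_finite_induct) (auto intro: polys_add)

lemma polys_mult:
  assumes "p \<in> polys V" "q \<in> polys V"
  shows "p * q \<in> polys V"
  unfolding polys_def
proof (intro CollectI ballI)
  fix m assume "m \<in> Poly_Mapping.keys (p * q)"
  then obtain a b where "m = a + b" "a \<in> Poly_Mapping.keys p" "b \<in> Poly_Mapping.keys q"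
    using keys_mult[of p q] by blast
  then show "Poly_Mapping.keys m \<subseteq> V"
    using assms keys_add[of a b] unfolding polys_def by blast
qed

lemma polys_single: "Poly_Mapping.keys m \<subseteq> V \<Longrightarrow> Poly_Mapping.single m c \<in> polys V"
  by (simp add: polys_def)

lemma polys_Const [simp]: "Const c \<in> polys V"
  by (simp add: Const_def polys_single)

lemma polys_Var: "i \<in> V \<Longrightarrow> Var i \<in> polys V"
  by (simp add: Var_def polys_single)

lemma polys_1: "1 \<in> polys V"
  using polys_Const[of 1 V] by (simp add: Const_def)

lemma polys_power: "p \<in> polys V \<Longrightarrow> p ^ n \<in> polys V"
  by (induction n) (auto intro: polys_mult polys_1)

lemma polys_scale: "p \<in> polys V \<Longrightarrow> pm_scale c p \<in> polys V"
  by (metis Const_mult polys_Const polys_mult)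

lemma polys_hcomp: "p \<in> polys V \<Longrightarrow> hcomp d p \<in> polys V"
  by (simp add: polys_def keys_hcomp)

lemma polys_mono: "V \<subseteq> W \<Longrightarrow> polys V \<subseteq> polys W"
  by (auto simp: polys_def)

lemma ideal_inD:
  assumes "ideal_in V I"
  shows "I \<subseteq> polys V" "0 \<in> I" "f \<in> I \<Longrightarrow> g \<in> I \<Longrightarrow> f + g \<in> I"
    "r \<in> polys V \<Longrightarrow> f \<in> I \<Longrightarrow> r * f \<in> I" "f \<in> I \<Longrightarrow> pm_scale c f \<in> I"
  using assms by (auto simp: ideal_in_def simp flip: Const_mult)

lemma ideal_inI:
  assumes "I \<subseteq> polys V" "0 \<in> I" "\<And>f g. f \<in> I \<Longrightarrow> g \<in> I \<Longrightarrow> f + g \<in> I"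
    "\<And>r f. r \<in> polys V \<Longrightarrow> f \<in> I \<Longrightarrow> r * f \<in> I"
  shows "ideal_in V I"
  using assms by (simp add: ideal_in_def)

lemma ideal_in_sum:
  "ideal_in V I \<Longrightarrow> (\<And>a. a \<in> A \<Longrightarrow> f a \<in> I) \<Longrightarrow> (\<Sum>a\<in>A. f a) \<in> I"
  by (induction A rule: infinite_finite_induct) (auto intro: ideal_inD)

lemma ideal_in_polys: "ideal_in V (polys V)"
  by (auto simp: ideal_in_def polys_add polys_mult)

lemma ideal_in_hull:
  fixes G :: "'k::field mpol set"
  assumes "G \<subseteq> polys V"
  shows "ideal_in V (ideal_in V hull G)"
proof -
  have "ideal_in V hull G \<subseteq> polys V"
    by (rule hull_minimal[where S = "ideal_in V", OF assms ideal_in_polys])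
  then show ?thesis
    by (intro ideal_inI) (auto simp: hull_def intro: ideal_inD)
qed

text \<open>The members of the hull whose components all stay in the hull form an ideal containing
  \<open>G\<close>; minimality of the hull makes this ideal everything.\<close>

lemma homogeneous_ideal_hull:
  fixes G :: "'k::field mpol set"
  assumes "G \<subseteq> polys V" "\<And>g. g \<in> G \<Longrightarrow> \<exists>d. form d g"
  shows "homogeneous_ideal V (ideal_in V hull G)"
proof -
  let ?H = "ideal_in V hull G"
  note H = ideal_inD[OF ideal_in_hull[OF assms(1)]]
  let ?J = "{f \<in> ?H. \<forall>d. hcomp d f \<in> ?H}"
  have "ideal_in V ?J"
  proof (rule ideal_inI)
    show "?J \<subseteq> polys V" using H(1) by blast
    show "0 \<in> ?J" using H(2) by simp
    show "f + g \<in> ?J" if "f \<in> ?J" "g \<in> ?J" for f g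
      using that by (simp add: hcomp_add H(3))
    show "r * f \<in> ?J" if r: "r \<in> polys V" and f: "f \<in> ?J" for r f
    proof -
      have "hcomp d (r * f) \<in> ?H" for d
        unfolding hcomp_mult
        using r f by (intro ideal_in_sum[OF ideal_in_hull[OF assms(1)]] H(4) polys_hcomp) simp_all
      then show ?thesis using r f H(4) by simp
    qed
  qed
  moreover have "G \<subseteq> ?J"
  proof
    fix g assume g: "g \<in> G"
    then obtain d where "form d g" using assms(2) by blast
    have "g \<in> ?H" using g by (rule hull_inc)
    moreover have "hcomp e g \<in> ?H" for e
      unfolding hcomp_form[OF \<open>form d g\<close>] using H(2) \<open>g \<in> ?H\<close> by simp
    ultimately show "g \<in> ?J" by simp
  qed
  ultimately have "?H \<subseteq> ?J" by (intro hull_minimal[where S = "ideal_in V"])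
  then have "hcomp d f \<in> ?H" if "f \<in> ?H" for d f using that by blast
  then show ?thesis
    using ideal_in_hull[OF assms(1)] by (simp add: homogeneous_ideal_def)
qed

section \<open>Spaces of forms of a fixed degree\<close>

lemma finite_monomials:
  assumes "finite V"
  shows "finite {m. Poly_Mapping.keys m \<subseteq> V \<and> mdeg m = d}"
proof -
  have "Poly_Mapping.lookup ` {m. Poly_Mapping.keys m \<subseteq> V \<and> mdeg m = d} \<subseteq>
      {f. \<forall>i. (i \<in> V \<longrightarrow> f i \<in> {..d}) \<and> (i \<notin> V \<longrightarrow> f i = 0)}"
  proof (clarsimp, intro conjI allI impI)
    fix m i assume *: "Poly_Mapping.keys m \<subseteq> V" "d = mdeg m"
    show "Poly_Mapping.lookup m i \<le> mdeg m" using mdeg_drop_var[of m i] by simp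
    show "Poly_Mapping.lookup m i = 0" if "i \<notin> V"
      using * that by (auto simp: in_keys_iff)
  qed
  then have "finite (Poly_Mapping.lookup ` {m. Poly_Mapping.keys m \<subseteq> V \<and> mdeg m = d})"
    by (rule finite_subset) (rule finite_set_of_finite_funs[OF assms], simp)
  then show ?thesis
    by (rule finite_imageD) (simp add: inj_on_def lookup_inject)
qed

lemma pm_scale_single: "pm_scale c (Poly_Mapping.single m a) = Poly_Mapping.single m (c * a)"
  by (rule poly_mapping_eqI) (simp add: lookup_pm_scale lookup_single when_def)

lemma forms_subset_span:
  "{f \<in> polys V. form d f} \<subseteq>
    pm.span ((\<lambda>m. Poly_Mapping.single m (1::'k::field)) ` {m. Poly_Mapping.keys m \<subseteq> V \<and> mdeg m = d})"
    (is "_ \<subseteq> pm.span ?T")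
proof
  fix f :: "'k mpol" assume f: "f \<in> {f \<in> polys V. form d f}"
  have "(\<Sum>m\<in>Poly_Mapping.keys f. pm_scale (Poly_Mapping.lookup f m) (Poly_Mapping.single m 1))
      \<in> pm.span ?T"
    using f by (intro pm.span_sum pm.span_scale pm.span_base imageI) (auto simp: polys_def form_def)
  then show "f \<in> pm.span ?T"
    by (simp add: pm_scale_single flip: poly_mapping_sum_singles)
qed

text \<open>In a linear relation, the coefficient at the monomial \<open>m\<close> isolates the
  scalar in front of that monomial.\<close>

lemma independent_singles:
  "pm.independent ((\<lambda>m. Poly_Mapping.single m (1::'k::field)) ` A)"
  unfolding pm.independent_explicit_finite_subsets
proof (intro allI impI ballI)
  fix S u v
  assume S: "S \<subseteq> (\<lambda>m. Poly_Mapping.single m (1::'k)) ` A" "finite S"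
    and 0: "(\<Sum>v\<in>S. pm_scale (u v) v) = 0" and v: "v \<in> S"
  from S v obtain m where m: "v = Poly_Mapping.single m 1" by auto
  have *: "Poly_Mapping.lookup w m = (if w = v then 1 else 0)" if "w \<in> S" for w
    using S(1) that m by (auto simp: lookup_single when_def)
  have "0 = Poly_Mapping.lookup (\<Sum>v\<in>S. pm_scale (u v) v) m" by (simp add: 0)
  also have "\<dots> = (\<Sum>w\<in>S. if w = v then u w else 0)"
    unfolding lookup_sum lookup_pm_scale by (rule sum.cong) (auto simp: *)
  also have "\<dots> = u v" using S(2) v by simp
  finally show "u v = 0" ..
qed

lemma dim_forms:
  "pm.dim {f :: 'k::field mpol. f \<in> polys V \<and> form d f} = card {m. Poly_Mapping.keys m \<subseteq> V \<and> mdeg m = d}"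
proof (rule pm.dim_unique)
  show "(\<lambda>m. Poly_Mapping.single m (1::'k)) ` {m. Poly_Mapping.keys m \<subseteq> V \<and> mdeg m = d}
      \<subseteq> {f \<in> polys V. form d f}"
    by (auto intro: polys_single form_single)
  show "card ((\<lambda>m. Poly_Mapping.single m (1::'k)) ` {m. Poly_Mapping.keys m \<subseteq> V \<and> mdeg m = d}) =
      card {m. Poly_Mapping.keys m \<subseteq> V \<and> mdeg m = d}"
    by (intro card_image inj_onI, drule arg_cong[where f = Poly_Mapping.keys]) simp
qed (use forms_subset_span independent_singles in auto)

section \<open>Dimensions\<close>

lemma (in vector_space) finite_basis_exists:
  assumes "finite T" "U \<subseteq> span T"
  obtains B where "finite B" "B \<subseteq> U" "independent B" "U \<subseteq> span B" "card B = dim U"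
proof -
  obtain B where B: "B \<subseteq> U" "independent B" "U \<subseteq> span B" "card B = dim U"
    by (rule basis_exists)
  moreover have "finite B"
    using independent_span_bound[OF assms(1) B(2)] B(1) assms(2) by blast
  ultimately show thesis using that by blast
qed

text \<open>The ambient spaces of polynomials are infinite-dimensional, so finiteness is asked of
  \<open>U\<close> only. A basis \<open>A\<close> of the kernel is extended to a basis
  \<open>B\<close> of \<open>U\<close>, and \<open>f\<close> carries \<open>B - A\<close>
  bijectively to a basis of the image.\<close>

lemma (in vector_space_pair) rank_nullity_subspace:
  assumes f: "Vector_Spaces.linear s1 s2 f" and U: "vs1.subspace U" and T: "finite T" "U \<subseteq> vs1.span T"
  shows "vs1.dim U = vs1.dim {x \<in> U. f x = 0} + vs2.dim (f ` U)"
proof -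
  interpret f: Vector_Spaces.linear s1 s2 f by (fact f)
  let ?K = "{x \<in> U. f x = 0}"
  obtain A where A: "A \<subseteq> ?K" "vs1.independent A" "?K \<subseteq> vs1.span A" "card A = vs1.dim ?K"
    by (rule vs1.basis_exists)
  obtain B where B: "A \<subseteq> B" "B \<subseteq> U" "vs1.independent B" "U \<subseteq> vs1.span B"
    using vs1.maximal_independent_subset_extend[of A U] A by blast
  have finB: "finite B"
    using vs1.independent_span_bound[OF T(1) B(3)] B(2) T(2) by blast
  have spB: "vs1.span B \<subseteq> U" using B(2) U by (rule vs1.span_minimal)
  have spC: "vs1.span (B - A) \<subseteq> U" using spB vs1.span_mono[of "B - A" B] by blast
  have inj: "inj_on f (vs1.span (B - A))"
  proof (subst f.inj_on_iff_eq_0[OF vs1.subspace_span], intro ballI impI)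
    fix x assume x: "x \<in> vs1.span (B - A)" "f x = 0"
    then have xA: "x \<in> vs1.span A" using A(3) spC by blast
    \<comment> \<open>The vector \<open>x\<close> lies in the spans of \<open>A\<close> and of
      \<open>B - A\<close>, so its coordinates in \<open>B\<close> are supported on two disjoint
      sets and vanish.\<close>
    have "vs1.representation B x = vs1.representation (B - A) x"
      using x(1) by (intro vs1.representation_extend B(3)) auto
    moreover have "vs1.representation B x = vs1.representation A x"
      using xA B(1) by (intro vs1.representation_extend B(3)) auto
    ultimately have "vs1.representation B x b = 0" for b
      using vs1.representation_ne_zero[of A x b] vs1.representation_ne_zero[of "B - A" x b]
      by (metis DiffD2)
    moreover have "x \<in> vs1.span B" using xA vs1.span_mono[OF B(1)] by blast
    ultimately show "x = 0"
      using vs1.sum_representation_eq[OF B(3) _ finB order.refl, of x] by simp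
  qed
  have fA: "f a = 0" if "a \<in> A" for a using A(1) that by blast
  have "f ` U \<subseteq> vs2.span (f ` B)" using B(4) by (rule f.spans_image)
  also have "vs2.span (f ` B) \<subseteq> vs2.span (f ` (B - A))"
  proof (rule vs2.span_minimal)
    show "f ` B \<subseteq> vs2.span (f ` (B - A))"
    proof (rule image_subsetI)
      fix b assume "b \<in> B"
      then show "f b \<in> vs2.span (f ` (B - A))"
        by (cases "b \<in> A") (auto simp: fA vs2.span_zero intro: vs2.span_base)
    qed
  qed simp
  finally have "f ` U \<subseteq> vs2.span (f ` (B - A))" .
  moreover have "vs2.independent (f ` (B - A))"
    using B(3) inj by (intro f.independent_injective_image vs1.independent_mono[OF B(3)]) auto
  ultimately have "vs2.dim (f ` U) = card (f ` (B - A))"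
    using B(2) by (intro vs2.basis_card_eq_dim[symmetric]) auto
  also have "\<dots> = card (B - A)"
    using inj vs1.span_superset by (intro card_image) (blast intro: inj_on_subset)
  finally have "vs2.dim (f ` U) = card (B - A)" .
  moreover have "card B = vs1.dim U" using B by (intro vs1.basis_card_eq_dim)
  moreover have "card B = card A + card (B - A)"
    using finB B(1) by (metis card_Diff_subset card_mono finite_subset le_add_diff_inverse)
  ultimately show ?thesis using A(4) by simp
qed

lemma (in vector_space_pair) dim_image_inj_on:
  assumes f: "Vector_Spaces.linear s1 s2 f" and U: "vs1.subspace U" and T: "finite T" "U \<subseteq> vs1.span T"
    and inj: "\<And>x. x \<in> U \<Longrightarrow> f x = 0 \<Longrightarrow> x = 0"
  shows "vs2.dim (f ` U) = vs1.dim U"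
proof -
  have "{x \<in> U. f x = 0} = {0}"
    using inj vs1.subspace_0[OF U] linear_0[OF f] by blast
  moreover have "vs1.dim {0} = 0"
    using vs1.dim_span[of "{}"] vs1.dim_eq_card_independent[OF vs1.independent_empty] by simp
  ultimately show ?thesis using rank_nullity_subspace[OF f U T] by simp
qed

section \<open>Free modules\<close>

lemma pm_scale_0_left [simp]: "pm_scale 0 f = 0"
  by (rule poly_mapping_eqI) (simp add: lookup_pm_scale)

lemma keys_pm_scale: "Poly_Mapping.keys (pm_scale c f) \<subseteq> Poly_Mapping.keys f"
  by (auto simp: in_keys_iff lookup_pm_scale)

text \<open>A common finite index set allows sums over different supports to be combined.\<close>

lemma lin_ext_superset:
  assumes "finite A" "Poly_Mapping.keys f \<subseteq> A"
  shows "lin_ext \<phi> f = (\<Sum>b\<in>A. pm_scale (Poly_Mapping.lookup f b) (\<phi> b))"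
  unfolding lin_ext_def using assms
  by (intro sum.mono_neutral_left) (auto simp: in_keys_iff)

lemma lookup_lin_ext:
  assumes "finite A" "Poly_Mapping.keys f \<subseteq> A"
  shows "Poly_Mapping.lookup (lin_ext \<phi> f) c = (\<Sum>b\<in>A. Poly_Mapping.lookup f b * Poly_Mapping.lookup (\<phi> b) c)"
  by (simp add: lin_ext_superset[OF assms] lookup_sum lookup_pm_scale)

lemma lin_ext_add: "lin_ext \<phi> (f + g) = lin_ext \<phi> f + lin_ext \<phi> g"
proof (rule poly_mapping_eqI)
  fix c
  let ?A = "Poly_Mapping.keys f \<union> Poly_Mapping.keys g"
  have A: "finite ?A" "Poly_Mapping.keys (f + g) \<subseteq> ?A" "Poly_Mapping.keys f \<subseteq> ?A" "Poly_Mapping.keys g \<subseteq> ?A"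
    using keys_add[of f g] by auto
  show "Poly_Mapping.lookup (lin_ext \<phi> (f + g)) c = Poly_Mapping.lookup (lin_ext \<phi> f + lin_ext \<phi> g) c"
    unfolding lookup_add[of "lin_ext \<phi> f"] A(2-4)[THEN lookup_lin_ext[OF A(1)]]
    by (simp add: lookup_add distrib_right sum.distrib)
qed

lemma lin_ext_scale: "lin_ext \<phi> (pm_scale c f) = pm_scale c (lin_ext \<phi> f)"
  unfolding lin_ext_superset[OF finite_keys keys_pm_scale[of c f]]
  by (rule poly_mapping_eqI)
    (simp add: lin_ext_def lookup_sum lookup_pm_scale sum_distrib_left mult.assoc)

lemma lin_ext_single: "lin_ext \<phi> (Poly_Mapping.single b c) = pm_scale c (\<phi> b)"
  by (subst lin_ext_superset[of "{b}"]) auto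

lemma lin_ext_0 [simp]: "lin_ext \<phi> 0 = 0"
  by (simp add: lin_ext_def)

lemma linear_lin_ext: "Vector_Spaces.linear pm_scale pm_scale (lin_ext \<phi> :: ('b \<Rightarrow>\<^sub>0 'k::field) \<Rightarrow> ('c \<Rightarrow>\<^sub>0 'k))"
  by (simp add: Vector_Spaces.linear_iff lin_ext_add lin_ext_scale pm.vector_space_axioms)

text \<open>The degree \<open>d\<close> component of an element of the graded free module whose
  generator \<open>b\<close> sits in degree \<open>g b\<close>. The guard \<open>g b \<le> d\<close>
  matters because the subtraction is truncated and would otherwise select constant
  coefficients.\<close>

definition ncomp :: "(nat \<Rightarrow> nat) \<Rightarrow> nat \<Rightarrow> (nat \<Rightarrow>\<^sub>0 'k::field mpol) \<Rightarrow> (nat \<Rightarrow>\<^sub>0 'k mpol)" where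
  "ncomp g d f = (\<Sum>b\<in>{b \<in> Poly_Mapping.keys f. g b \<le> d}.
     Poly_Mapping.single b (hcomp (d - g b) (Poly_Mapping.lookup f b)))"

lemma lookup_ncomp:
  "Poly_Mapping.lookup (ncomp g d f) b = (if g b \<le> d then hcomp (d - g b) (Poly_Mapping.lookup f b) else 0)"
  by (auto simp: ncomp_def lookup_sum lookup_single when_def in_keys_iff)

lemma homogeneous_ncomp: "homogeneous_elt g d (ncomp g d f)"
  by (auto simp: homogeneous_elt_def in_keys_iff lookup_ncomp form_hcomp split: if_splits)

lemma free_module_ncomp:
  assumes "f \<in> free_module V B"
  shows "ncomp g d f \<in> free_module V B"
proof -
  have "Poly_Mapping.keys (ncomp g d f) \<subseteq> Poly_Mapping.keys f"
    by (auto simp: in_keys_iff lookup_ncomp split: if_splits)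
  then show ?thesis using assms by (auto simp: free_module_def lookup_ncomp polys_hcomp)
qed

text \<open>The set \<open>D\<close> collects the total degrees of the finitely many terms occurring
  in \<open>f\<close>.\<close>

lemma sum_ncomp: "\<exists>D. finite D \<and> (\<Sum>d\<in>D. ncomp g d f) = f"
proof -
  let ?D = "\<Union>b\<in>Poly_Mapping.keys f. (\<lambda>m. g b + mdeg m) ` Poly_Mapping.keys (Poly_Mapping.lookup f b)"
  have "(\<Sum>d\<in>?D. ncomp g d f) = f"
  proof (intro poly_mapping_eqI)
    fix b m
    let ?c = "Poly_Mapping.lookup (Poly_Mapping.lookup f b) m"
    have "?c = 0" if "g b + mdeg m \<notin> ?D"
    proof (rule ccontr)
      assume "?c \<noteq> 0"
      then have "b \<in> Poly_Mapping.keys f" "m \<in> Poly_Mapping.keys (Poly_Mapping.lookup f b)"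
        by (auto simp: in_keys_iff)
      then show False using that by blast
    qed
    moreover have "Poly_Mapping.lookup (Poly_Mapping.lookup (\<Sum>d\<in>?D. ncomp g d f) b) m =
        (\<Sum>d\<in>?D. if d = g b + mdeg m then ?c else 0)"
      unfolding lookup_sum by (rule sum.cong) (auto simp: lookup_ncomp lookup_hcomp)
    ultimately show "Poly_Mapping.lookup (Poly_Mapping.lookup (\<Sum>d\<in>?D. ncomp g d f) b) m = ?c"
      by simp
  qed
  moreover have "finite ?D" by simp
  ultimately show ?thesis by blast
qed

text \<open>The matrix entry from \<open>b\<close> to \<open>c\<close> is a form of degree
  \<open>g b - g0 c\<close>, so the map is homogeneous of degree zero and respects
  components.\<close>

lemma ncomp_lin_ext:
  assumes "\<And>b. b \<in> Poly_Mapping.keys f \<Longrightarrow> homogeneous_elt g0 (g b) (\<phi> b)"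
  shows "ncomp g0 d (lin_ext \<phi> f) = lin_ext \<phi> (ncomp g d f)"
proof (rule poly_mapping_eqI)
  fix c
  let ?A = "Poly_Mapping.keys f"
  have A: "Poly_Mapping.keys (ncomp g d f) \<subseteq> ?A"
    by (auto simp: in_keys_iff lookup_ncomp split: if_splits)
  have *: "(if g0 c \<le> d then hcomp (d - g0 c) (Poly_Mapping.lookup f b * Poly_Mapping.lookup (\<phi> b) c) else 0)
    = Poly_Mapping.lookup (ncomp g d f) b * Poly_Mapping.lookup (\<phi> b) c" if "b \<in> ?A" for b
  \<comment> \<open>Only a nonzero entry forces \<open>g0 c \<le> g b\<close>.\<close>
  proof (cases "Poly_Mapping.lookup (\<phi> b) c = 0")
    case False
    then have le: "g0 c \<le> g b" and fm: "form (g b - g0 c) (Poly_Mapping.lookup (\<phi> b) c)"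
      using assms[OF that] by (auto simp: homogeneous_elt_def in_keys_iff)
    then show ?thesis
      by (auto simp: hcomp_mult_form[OF fm] lookup_ncomp)
  qed simp
  have "Poly_Mapping.lookup (ncomp g0 d (lin_ext \<phi> f)) c =
     (\<Sum>b\<in>?A. if g0 c \<le> d then hcomp (d - g0 c) (Poly_Mapping.lookup f b * Poly_Mapping.lookup (\<phi> b) c) else 0)"
    unfolding lookup_ncomp lookup_lin_ext[OF finite_keys order.refl] hcomp_sum by simp
  also have "\<dots> = Poly_Mapping.lookup (lin_ext \<phi> (ncomp g d f)) c"
    unfolding lookup_lin_ext[OF finite_keys A] by (rule sum.cong) (auto simp: *)
  finally show "Poly_Mapping.lookup (ncomp g0 d (lin_ext \<phi> f)) c = Poly_Mapping.lookup (lin_ext \<phi> (ncomp g d f)) c" .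
qed

lemma free_module_0 [simp]: "0 \<in> free_module V B"
  by (simp add: free_module_def)

lemma free_module_add: "f \<in> free_module V B \<Longrightarrow> h \<in> free_module V B \<Longrightarrow> f + h \<in> free_module V B"
  unfolding free_module_def using keys_add[of f h] by (auto simp: lookup_add polys_add)

lemma free_module_scale: "r \<in> polys V \<Longrightarrow> f \<in> free_module V B \<Longrightarrow> pm_scale r f \<in> free_module V B"
  unfolding free_module_def using keys_pm_scale[of r f] by (auto simp: lookup_pm_scale polys_mult)

lemma free_module_single: "b \<in> B \<Longrightarrow> p \<in> polys V \<Longrightarrow> Poly_Mapping.single b p \<in> free_module V B"
  by (auto simp: free_module_def lookup_single when_def)

definition submodule :: "nat set \<Rightarrow> (nat \<Rightarrow>\<^sub>0 'k::field mpol) set \<Rightarrow> bool" where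
  "submodule V K \<longleftrightarrow> 0 \<in> K \<and> (\<forall>f\<in>K. \<forall>h\<in>K. f + h \<in> K) \<and> (\<forall>r\<in>polys V. \<forall>f\<in>K. pm_scale r f \<in> K)"

lemma submodule_sum: "submodule V K \<Longrightarrow> (\<And>a. a \<in> A \<Longrightarrow> f a \<in> K) \<Longrightarrow> (\<Sum>a\<in>A. f a) \<in> K"
  by (induction A rule: infinite_finite_induct) (auto simp: submodule_def)

lemma submodule_lin_ext_image: "submodule V (lin_ext \<phi> ` free_module V B)"
  unfolding submodule_def
proof (intro conjI ballI)
  have "lin_ext \<phi> 0 \<in> lin_ext \<phi> ` free_module V B" by (rule imageI) simp
  then show "0 \<in> lin_ext \<phi> ` free_module V B" by simp
  fix f assume "f \<in> lin_ext \<phi> ` free_module V B"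
  then obtain f' where f: "f = lin_ext \<phi> f'" "f' \<in> free_module V B" by blast
  show "f + h \<in> lin_ext \<phi> ` free_module V B" if "h \<in> lin_ext \<phi> ` free_module V B" for h
    using that f by (auto simp flip: lin_ext_add intro: free_module_add)
  show "pm_scale r f \<in> lin_ext \<phi> ` free_module V B" if "r \<in> polys V" for r
    using that f by (auto simp flip: lin_ext_scale intro: free_module_scale)
qed

section \<open>Graded free resolutions\<close>

definition graded_submodule ::
    "nat set \<Rightarrow> nat set \<Rightarrow> (nat \<Rightarrow> nat) \<Rightarrow> (nat \<Rightarrow>\<^sub>0 'k::field mpol) set \<Rightarrow> bool" where
  "graded_submodule V B g K \<longleftrightarrow>
     submodule V K \<and> K \<subseteq> free_module V B \<and> (\<forall>f\<in>K. \<forall>d. ncomp g d f \<in> K)"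

lemma Const_add: "Const (a + b) = Const a + Const b"
  by (simp add: Const_def single_add)

text \<open>Restricting scalars to the constants turns a free module into a vector space over the
  ground field, so that bases of its graded pieces can be chosen.\<close>

lemma vector_space_Const_scale:
  "vector_space (\<lambda>c::'k::field. pm_scale (Const c) :: ('b \<Rightarrow>\<^sub>0 'k mpol) \<Rightarrow> _)"
proof
  show "pm_scale (Const a) (pm_scale (Const b) x) = pm_scale (Const (a * b)) x"
    for a b :: 'k and x :: "'b \<Rightarrow>\<^sub>0 'k mpol"
    by (rule poly_mapping_eqI)
      (simp add: lookup_pm_scale Const_def mult_single flip: mult.assoc)
  show "pm_scale (Const 1) x = x" for x :: "'b \<Rightarrow>\<^sub>0 'k mpol"
    by (rule poly_mapping_eqI) (simp add: lookup_pm_scale Const_def)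
qed (rule poly_mapping_eqI, simp add: lookup_pm_scale lookup_add Const_add distrib_left distrib_right)+

text \<open>Degree \<open>d\<close> is spanned by monomials times generators of total degree
  \<open>d\<close>. Only the finitely many generators of degree at most \<open>d\<close> occur, each
  with finitely many monomials.\<close>

lemma finite_homogeneous_spanning_set:
  fixes B :: "nat set" and V
  assumes "finite V" "\<And>d. finite {b \<in> B. g b = d}"
  shows "\<exists>T. finite T \<and> {f \<in> free_module V B. homogeneous_elt g d f} \<subseteq>
    module.span (\<lambda>c::'k::field. pm_scale (Const c)) T"
proof -
  interpret vector_space "\<lambda>c::'k. pm_scale (Const c) :: (nat \<Rightarrow>\<^sub>0 'k mpol) \<Rightarrow> _"
    by (rule vector_space_Const_scale)
  let ?B = "\<Union>e\<in>{..d}. {b \<in> B. g b = e}"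
  let ?T = "(\<lambda>(b, m). Poly_Mapping.single b (Poly_Mapping.single m (1::'k))) `
    (SIGMA b:?B. {m. Poly_Mapping.keys m \<subseteq> V \<and> mdeg m = d - g b})"
  have "finite ?T"
    using assms finite_monomials by (intro finite_imageI finite_SigmaI finite_UN_I) auto
  moreover have "f \<in> span ?T" if f: "f \<in> free_module V B" "homogeneous_elt g d f" for f
  proof -
    have "Poly_Mapping.single b (Poly_Mapping.lookup f b) \<in> span ?T" if b: "b \<in> Poly_Mapping.keys f" for b
    proof -
      let ?p = "Poly_Mapping.lookup f b"
      have p: "form (d - g b) ?p" "b \<in> ?B" "?p \<in> polys V"
        using f b by (auto simp: homogeneous_elt_def free_module_def)
      have "(\<Sum>m\<in>Poly_Mapping.keys ?p. pm_scale (Const (Poly_Mapping.lookup ?p m))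
          (Poly_Mapping.single b (Poly_Mapping.single m 1))) \<in> span ?T"
      proof (intro span_sum span_scale span_base)
        fix m assume "m \<in> Poly_Mapping.keys ?p"
        then have "(b, m) \<in> (SIGMA b:?B. {m. Poly_Mapping.keys m \<subseteq> V \<and> mdeg m = d - g b})"
          using p by (auto simp: form_def polys_def)
        then show "Poly_Mapping.single b (Poly_Mapping.single m 1) \<in> ?T" by (rule rev_image_eqI) simp
      qed
      also have "(\<Sum>m\<in>Poly_Mapping.keys ?p. pm_scale (Const (Poly_Mapping.lookup ?p m))
          (Poly_Mapping.single b (Poly_Mapping.single m 1))) = Poly_Mapping.single b ?p"
        by (intro poly_mapping_eqI)
          (simp add: lookup_sum lookup_pm_scale lookup_single when_def Const_def mult_single in_keys_iff)
      finally show ?thesis .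
    qed
    then have "(\<Sum>b\<in>Poly_Mapping.keys f. Poly_Mapping.single b (Poly_Mapping.lookup f b)) \<in> span ?T"
      by (rule span_sum)
    then show ?thesis by (simp flip: poly_mapping_sum_singles)
  qed
  ultimately show ?thesis by blast
qed

text \<open>One step of a resolution: a vector space basis of every graded piece of \<open>K\<close>
  is taken as generating set. The total number of generators may be infinite, but it is finite in
  each degree.\<close>

lemma homogeneous_generators:
  fixes K :: "(nat \<Rightarrow>\<^sub>0 'k::field mpol) set"
  assumes V: "finite V" and B: "\<And>d. finite {b \<in> B. g b = d}" and K: "graded_submodule V B g K"
  obtains B' g' \<delta> where "\<And>d. finite {b \<in> B'. g' b = d}"
    "\<And>b. b \<in> B' \<Longrightarrow> \<delta> b \<in> K \<and> homogeneous_elt g (g' b) (\<delta> b)"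
    "lin_ext \<delta> ` free_module V B' = K"
proof -
  interpret vector_space "\<lambda>c::'k. pm_scale (Const c) :: (nat \<Rightarrow>\<^sub>0 'k mpol) \<Rightarrow> _"
    by (rule vector_space_Const_scale)
  have sub: "submodule V K" and KB: "K \<subseteq> free_module V B" and comp: "\<And>f d. f \<in> K \<Longrightarrow> ncomp g d f \<in> K"
    using K by (auto simp: graded_submodule_def)
  let ?Kd = "\<lambda>d. {f \<in> K. homogeneous_elt g d f}"
  have "\<exists>xs. set xs \<subseteq> ?Kd d \<and> ?Kd d \<subseteq> span (set xs)" for d
  proof -
    obtain T where T: "finite T" "{f \<in> free_module V B. homogeneous_elt g d f} \<subseteq> span T"
      using finite_homogeneous_spanning_set[OF V B] by blast
    then have "?Kd d \<subseteq> span T" using KB by blast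
    then obtain A where A: "finite A" "A \<subseteq> ?Kd d" "?Kd d \<subseteq> span A"
      by (rule finite_basis_exists[OF T(1)])
    obtain ys where "set ys = A" using finite_list[OF A(1)] by blast
    then show ?thesis using A(2,3) by (intro exI[of _ ys]) simp
  qed
  then have "\<exists>xs. \<forall>d. set (xs d) \<subseteq> ?Kd d \<and> ?Kd d \<subseteq> span (set (xs d))"
    by (intro choice allI)
  then obtain xs where xs: "\<And>d. set (xs d) \<subseteq> ?Kd d" "\<And>d. ?Kd d \<subseteq> span (set (xs d))"
    by blast
  \<comment> \<open>Generators of a \<open>free_complex\<close> are natural numbers, so the
    \<open>i\<close>-th basis element in degree \<open>d\<close> is labelled by the code of
    \<open>(d, i)\<close>.\<close>
  define B' where "B' = prod_encode ` (SIGMA d:UNIV. {..<length (xs d)})"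
  define g' where "g' b = fst (prod_decode b)" for b
  define \<delta> where "\<delta> b = xs (g' b) ! snd (prod_decode b)" for b
  have \<delta>: "\<delta> b \<in> ?Kd (g' b)" if "b \<in> B'" for b
  proof -
    have "\<delta> b \<in> set (xs (g' b))"
      using that by (auto simp: B'_def \<delta>_def g'_def)
    then show ?thesis using xs(1) by blast
  qed
  have "{b \<in> B'. g' b = d} \<subseteq> (\<lambda>i. prod_encode (d, i)) ` {..<length (xs d)}" for d
    by (auto simp: B'_def g'_def)
  then have 1: "finite {b \<in> B'. g' b = d}" for d
    by (rule finite_subset) simp
  have "lin_ext \<delta> ` free_module V B' \<subseteq> K"
  proof (rule image_subsetI)
    fix f :: "nat \<Rightarrow>\<^sub>0 'k mpol"
    assume f: "f \<in> free_module V B'"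
    show "lin_ext \<delta> f \<in> K"
      unfolding lin_ext_def
    proof (rule submodule_sum[OF sub])
      fix b assume "b \<in> Poly_Mapping.keys f"
      then have "b \<in> B'" "Poly_Mapping.lookup f b \<in> polys V" using f by (auto simp: free_module_def)
      then show "pm_scale (Poly_Mapping.lookup f b) (\<delta> b) \<in> K"
        using \<delta> sub by (auto simp: submodule_def)
    qed
  qed
  moreover have "K \<subseteq> lin_ext \<delta> ` free_module V B'"
  proof
    let ?M = "lin_ext \<delta> ` free_module V B'"
    have M: "submodule V ?M" by (rule submodule_lin_ext_image)
    then have "subspace ?M" by (auto simp: subspace_def submodule_def)
    moreover have "set (xs d) \<subseteq> ?M" for d
    proof
      fix x assume "x \<in> set (xs d)"
      then obtain i where i: "i < length (xs d)" "x = xs d ! i" by (auto simp: in_set_conv_nth)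
      let ?b = "prod_encode (d, i)"
      have "?b \<in> B'" using i by (auto simp: B'_def)
      moreover have "(1 :: 'k mpol) \<in> polys V" by (rule polys_1)
      moreover have "lin_ext \<delta> (Poly_Mapping.single ?b 1) = x"
        using i by (intro poly_mapping_eqI) (simp add: lin_ext_single \<delta>_def g'_def lookup_pm_scale)
      ultimately show "x \<in> ?M" using free_module_single by (metis rev_image_eqI)
    qed
    ultimately have "?Kd d \<subseteq> ?M" for d
      using xs(2)[of d] span_minimal[of "set (xs d)" ?M] by blast
    \<comment> \<open>The image contains each homogeneous piece of \<open>K\<close>, hence all
      components of \<open>f\<close> and their sum.\<close>
    then have "ncomp g d f \<in> ?M" if "f \<in> K" for d f
      using comp[OF that] homogeneous_ncomp by blast
    then show "f \<in> ?M" if "f \<in> K" for f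
      using sum_ncomp[of g f] submodule_sum[OF M] that by metis
  qed
  ultimately show thesis using that[of B' g' \<delta>] 1 \<delta> by blast
qed

text \<open>Since a homogeneous map commutes with taking components, it kills every component of an
  element of its kernel.\<close>

lemma graded_submodule_kernel:
  assumes "\<And>b. b \<in> B \<Longrightarrow> homogeneous_elt g0 (g b) (\<delta> b)"
  shows "graded_submodule V B g {f \<in> free_module V B. lin_ext \<delta> f = 0}"
proof -
  have "lin_ext \<delta> (ncomp g d f) = 0" if f: "f \<in> free_module V B" "lin_ext \<delta> f = 0" for d f
  proof -
    have "ncomp g0 d (lin_ext \<delta> f) = lin_ext \<delta> (ncomp g d f)"
      using f(1) assms by (intro ncomp_lin_ext) (auto simp: free_module_def)
    moreover have "ncomp g0 d 0 = (0 :: nat \<Rightarrow>\<^sub>0 'a mpol)" by (simp add: ncomp_def)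
    ultimately show ?thesis by (simp add: f(2))
  qed
  then show ?thesis
    by (auto simp: graded_submodule_def submodule_def lin_ext_add lin_ext_scale
        free_module_ncomp free_module_add free_module_scale)
       (auto intro: poly_mapping_eqI simp: lookup_pm_scale)
qed

text \<open>Placing the ideal inside the free module of rank one, with its generator in degree 0,
  lets the augmentation be built by the same step as the differentials.\<close>

lemma graded_submodule_single:
  assumes "homogeneous_ideal V I"
  shows "graded_submodule V {0} (\<lambda>_. 0) (Poly_Mapping.single 0 ` I)"
proof -
  have I: "ideal_in V I" "\<And>f d. f \<in> I \<Longrightarrow> hcomp d f \<in> I"
    using assms by (auto simp: homogeneous_ideal_def)
  have n: "ncomp (\<lambda>_. 0) d (Poly_Mapping.single 0 f) = Poly_Mapping.single 0 (hcomp d f)" for d f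
    by (rule poly_mapping_eqI) (simp add: lookup_ncomp lookup_single when_def)
  show ?thesis
    unfolding graded_submodule_def submodule_def
  proof (intro conjI ballI allI)
    show "0 \<in> Poly_Mapping.single 0 ` I"
      using ideal_inD(2)[OF I(1)] by (rule rev_image_eqI) simp
    show "Poly_Mapping.single 0 ` I \<subseteq> free_module V {0}"
      using ideal_inD(1)[OF I(1)] by (auto intro: free_module_single)
    fix f assume "f \<in> Poly_Mapping.single (0::nat) ` I"
    then obtain f' where f: "f = Poly_Mapping.single 0 f'" "f' \<in> I" by blast
    show "ncomp (\<lambda>_. 0) d f \<in> Poly_Mapping.single 0 ` I" for d
      using f I(2) by (simp add: n)
    show "pm_scale r f \<in> Poly_Mapping.single 0 ` I" if "r \<in> polys V" for r
      using f ideal_inD(4)[OF I(1) that] by (simp add: pm_scale_single)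
    show "f + h \<in> Poly_Mapping.single 0 ` I" if "h \<in> Poly_Mapping.single 0 ` I" for h
      using f that ideal_inD(3)[OF I(1)] by (auto simp flip: single_add)
  qed
qed

text \<open>The step \<open>homogeneous_generators\<close> is iterated by dependent choice, first on
  \<open>I\<close> and then on the kernel of the map just built. Existence gives meaning to the
  resolution selected in \<open>tor_dim\<close>.\<close>

lemma graded_free_resolution_exists:
  fixes I :: "'k::field mpol set"
  assumes V: "finite V" and I: "homogeneous_ideal V I"
  shows "\<exists>F. graded_free_resolution V I F"
proof -
  let ?K = "Poly_Mapping.single (0::nat) ` I"
  \<comment> \<open>A stage consists of generators, their degrees and their images;
    \<open>ker\<close> is its module of syzygies, to be covered by the next stage.\<close>
  define ker where "ker s = {f \<in> free_module V (fst s). lin_ext (snd (snd s)) f = 0}"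
    for s :: "nat set \<times> (nat \<Rightarrow> nat) \<times> (nat \<Rightarrow> (nat \<Rightarrow>\<^sub>0 'k mpol))"
  \<comment> \<open>The invariant says that the syzygies are graded, as the next application of
    \<open>homogeneous_generators\<close> requires; the clause for \<open>n = 0\<close> makes the
    first stage cover \<open>I\<close>.\<close>
  define P where "P n = (\<lambda>(B, g, \<delta>). (\<forall>d. finite {b \<in> B. g b = d}) \<and>
      graded_submodule V B g (ker (B, g, \<delta>)) \<and>
      (n = (0::nat) \<longrightarrow> (\<forall>b\<in>B. \<delta> b \<in> ?K \<and> homogeneous_elt (\<lambda>_. 0) (g b) (\<delta> b)) \<and>
         lin_ext \<delta> ` free_module V B = ?K))" for n
  define Q where "Q (n::nat) s = (\<lambda>(B, g, \<delta>). (\<forall>b\<in>B. \<delta> b \<in> ker s \<and> homogeneous_elt (fst (snd s)) (g b) (\<delta> b)) \<and>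
      lin_ext \<delta> ` free_module V B = ker s)" for n s
  have "\<exists>s. P 0 s"
  proof -
    obtain B g \<delta> where s: "\<And>d. finite {b \<in> B. g b = d}"
      "\<And>b. b \<in> B \<Longrightarrow> \<delta> b \<in> ?K \<and> homogeneous_elt (\<lambda>_. 0) (g b) (\<delta> b)"
      "lin_ext \<delta> ` free_module V B = ?K"
      by (rule homogeneous_generators[OF V _ graded_submodule_single[OF I]]) auto
    have "graded_submodule V B g (ker (B, g, \<delta>))"
      unfolding ker_def fst_conv snd_conv using s(2) by (intro graded_submodule_kernel) blast
    then have "P 0 (B, g, \<delta>)" using s by (simp add: P_def)
    then show ?thesis ..
  qed
  moreover have "\<exists>s'. P (Suc n) s' \<and> Q n s s'" if "P n s" for n s
  proof -
    obtain B g \<delta> where s: "s = (B, g, \<delta>)" by (cases s)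
    obtain B' g' \<delta>' where s': "\<And>d. finite {b \<in> B'. g' b = d}"
      "\<And>b. b \<in> B' \<Longrightarrow> \<delta>' b \<in> ker s \<and> homogeneous_elt g (g' b) (\<delta>' b)"
      "lin_ext \<delta>' ` free_module V B' = ker s"
    proof (rule homogeneous_generators[OF V, of B g "ker s"])
      show "finite {b \<in> B. g b = d}" for d using \<open>P n s\<close> by (simp add: s P_def)
      show "graded_submodule V B g (ker s)" using \<open>P n s\<close> by (simp add: s P_def)
    qed blast
    have "graded_submodule V B' g' (ker (B', g', \<delta>'))"
      unfolding ker_def fst_conv snd_conv using s'(2) by (intro graded_submodule_kernel) blast
    then have "P (Suc n) (B', g', \<delta>')" "Q n s (B', g', \<delta>')" using s' by (simp_all add: P_def Q_def s)
    then show ?thesis by blast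
  qed
  ultimately obtain s where P: "\<And>n. P n (s n)" and Q: "\<And>n. Q n (s n) (s (Suc n))"
    using dependent_nat_choice[of P Q] by blast
  define B g \<delta> where "B i = fst (s i)" and "g i = fst (snd (s i))" and "\<delta> i = snd (snd (s i))" for i
  have s: "s i = (B i, g i, \<delta> i)" for i by (simp add: B_def g_def \<delta>_def)
  \<comment> \<open>The indices shift by one: stage 0 is the augmentation, read off at the only
    coordinate 0 of the rank one module, and stage \<open>Suc i\<close> supplies \<open>diff\<close>
    at \<open>i\<close>.\<close>
  let ?F = "\<lparr>gens = B, gdeg = g, diff = \<lambda>i. \<delta> (Suc i), aug = \<lambda>b. Poly_Mapping.lookup (\<delta> 0 b) 0\<rparr>"
  have fin: "finite {b \<in> B i. g i b = d}" for i d
    using P[of i] by (auto simp: s P_def)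
  have \<delta>0: "\<And>b. b \<in> B 0 \<Longrightarrow> \<delta> 0 b \<in> ?K \<and> homogeneous_elt (\<lambda>_. 0) (g 0 b) (\<delta> 0 b)"
    and im0: "lin_ext (\<delta> 0) ` free_module V (B 0) = ?K"
    using P[of 0] by (auto simp: s P_def)
  have k: "ker (s i) = {f \<in> free_module V (B i). lin_ext (\<delta> i) f = 0}" for i
    by (simp add: s ker_def)
  have \<delta>S: "\<And>b. b \<in> B (Suc i) \<Longrightarrow> \<delta> (Suc i) b \<in> ker (s i) \<and> homogeneous_elt (g i) (g (Suc i) b) (\<delta> (Suc i) b)"
    and im: "lin_ext (\<delta> (Suc i)) ` free_module V (B (Suc i)) = ker (s i)" for i
    using Q[of i] by (auto simp: s Q_def)
  have am: "aug_map ?F f = Poly_Mapping.lookup (lin_ext (\<delta> 0) f) 0" for f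
    by (simp add: aug_map_def lookup_lin_ext[OF finite_keys order.refl])
  \<comment> \<open>Elements of \<open>?K\<close> are supported at coordinate 0, so they vanish as
    soon as this coordinate does.\<close>
  have am0: "aug_map ?F f = 0 \<longleftrightarrow> lin_ext (\<delta> 0) f = 0" if "f \<in> free_module V (B 0)" for f
  proof -
    have "lin_ext (\<delta> 0) f \<in> ?K" using im0 that by blast
    then show ?thesis by (auto simp: am)
  qed
  have "graded_free_resolution V I ?F"
    unfolding graded_free_resolution_def
  proof (intro conjI allI ballI)
    show "finite {b \<in> gens ?F i. gdeg ?F i b = d}" for i d by (simp add: fin)
    fix b assume "b \<in> gens ?F 0"
    then have b: "\<delta> 0 b \<in> ?K" "homogeneous_elt (\<lambda>_. 0) (g 0 b) (\<delta> 0 b)" using \<delta>0 by auto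
    then show "aug ?F b \<in> I" by auto
    from b(2) show "form (gdeg ?F 0 b) (aug ?F b)"
      by (cases "0 \<in> Poly_Mapping.keys (\<delta> 0 b)") (auto simp: homogeneous_elt_def in_keys_iff)
  next
    fix i b assume "b \<in> gens ?F (Suc i)"
    then show "diff ?F i b \<in> free_module V (gens ?F i)"
      "homogeneous_elt (gdeg ?F i) (gdeg ?F (Suc i) b) (diff ?F i b)"
      using \<delta>S by (auto simp: k)
  next
    have "aug_map ?F ` free_module V (gens ?F 0) = (\<lambda>f. Poly_Mapping.lookup f 0) ` lin_ext (\<delta> 0) ` free_module V (B 0)"
      by (simp add: am image_image)
    then show "aug_map ?F ` free_module V (gens ?F 0) = I"
      by (simp add: im0 image_image)
  next
    show "{f \<in> free_module V (gens ?F 0). aug_map ?F f = 0} = lin_ext (diff ?F 0) ` free_module V (gens ?F 1)"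
      using im[of 0] am0 by (auto simp: k)
    show "{f \<in> free_module V (gens ?F (Suc i)). lin_ext (diff ?F i) f = 0} =
        lin_ext (diff ?F (Suc i)) ` free_module V (gens ?F (Suc (Suc i)))" for i
      using im[of "Suc i"] by (simp add: k)
  qed
  then show ?thesis ..
qed

section \<open>Generators of lowest degree\<close>

text \<open>The image of the degree \<open>j\<close> part of a free module in \<open>F \<otimes> k\<close>.\<close>

definition const_part :: "(nat \<Rightarrow> nat) \<Rightarrow> nat \<Rightarrow> (nat \<Rightarrow>\<^sub>0 'k::field mpol) \<Rightarrow> (nat \<Rightarrow>\<^sub>0 'k)" where
  "const_part g j h = (\<Sum>b\<in>{b \<in> Poly_Mapping.keys h. g b = j}.
     Poly_Mapping.single b (const_coeff (Poly_Mapping.lookup h b)))"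

lemma lookup_const_part:
  "Poly_Mapping.lookup (const_part g j h) b = (if g b = j then const_coeff (Poly_Mapping.lookup h b) else 0)"
  by (auto simp: const_part_def lookup_sum lookup_single when_def in_keys_iff)

lemma keys_const_part: "Poly_Mapping.keys (const_part g j h) \<subseteq> {b \<in> Poly_Mapping.keys h. g b = j}"
  by (auto simp: in_keys_iff lookup_const_part split: if_splits)

lemma lookup_map_Const: "Poly_Mapping.lookup (Poly_Mapping.map Const f) b = Const (Poly_Mapping.lookup f b)"
  by (simp add: Poly_Mapping.map.rep_eq when_def Const_def)

lemma keys_map_Const: "Poly_Mapping.keys (Poly_Mapping.map Const f) \<subseteq> Poly_Mapping.keys f"
  by (auto simp: in_keys_iff lookup_map_Const Const_def)

lemma free_module_map_Const: "Poly_Mapping.keys f \<subseteq> B \<Longrightarrow> Poly_Mapping.map Const f \<in> free_module V B"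
  using keys_map_Const[of f] by (auto simp: free_module_def lookup_map_Const)

lemma const_part_map_Const:
  assumes "\<And>b. b \<in> Poly_Mapping.keys f \<Longrightarrow> g b = j"
  shows "const_part g j (Poly_Mapping.map Const f) = f"
proof (rule poly_mapping_eqI)
  show "Poly_Mapping.lookup (const_part g j (Poly_Mapping.map Const f)) b = Poly_Mapping.lookup f b" for b
    using assms[of b] by (auto simp: lookup_const_part lookup_map_Const in_keys_iff)
qed

lemma const_coeff_form: "form d p \<Longrightarrow> d \<noteq> 0 \<Longrightarrow> const_coeff p = 0"
  using mdeg_0 unfolding form_def const_coeff_def not_in_keys_iff_lookup_eq_zero[symmetric] by metis

lemma Const_eq_0_iff: "Const c = 0 \<longleftrightarrow> c = 0"
  using const_coeff_Const[of c] by (auto simp: Const_def)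

lemma lookup_map_const_coeff:
  "Poly_Mapping.lookup (Poly_Mapping.map const_coeff f) b = const_coeff (Poly_Mapping.lookup f b)"
  by (simp add: Poly_Mapping.map.rep_eq when_def)

text \<open>Passage to the tensor product with the residue field commutes with the differentials:
  constant coefficients multiply, and an entry with nonzero constant coefficient joins generators of
  equal degree, so the degree \<open>j\<close> strand is preserved.\<close>

lemma const_part_lin_ext:
  assumes "\<And>b. b \<in> Poly_Mapping.keys w \<Longrightarrow> homogeneous_elt g0 (g b) (\<phi> b)"
  shows "const_part g0 j (lin_ext \<phi> w) = lin_ext (\<lambda>b. Poly_Mapping.map const_coeff (\<phi> b)) (const_part g j w)"
proof (rule poly_mapping_eqI)
  fix c
  have deg: "g b = g0 c" if "b \<in> Poly_Mapping.keys w" "const_coeff (Poly_Mapping.lookup (\<phi> b) c) \<noteq> 0" for b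
  proof -
    have "c \<in> Poly_Mapping.keys (\<phi> b)" using that(2) by (auto simp: in_keys_iff)
    then have "g0 c \<le> g b" "form (g b - g0 c) (Poly_Mapping.lookup (\<phi> b) c)"
      using assms[OF that(1)] by (auto simp: homogeneous_elt_def)
    then show ?thesis using that(2) const_coeff_form by fastforce
  qed
  have "Poly_Mapping.keys (const_part g j w) \<subseteq> Poly_Mapping.keys w" using keys_const_part[of g j w] by blast
  note R = lookup_lin_ext[OF finite_keys this]
  note L = lookup_lin_ext[OF finite_keys order.refl[of "Poly_Mapping.keys w"]]
  show "Poly_Mapping.lookup (const_part g0 j (lin_ext \<phi> w)) c =
      Poly_Mapping.lookup (lin_ext (\<lambda>b. Poly_Mapping.map const_coeff (\<phi> b)) (const_part g j w)) c"
  proof (cases "g0 c = j")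
    case True
    then show ?thesis
      unfolding R L lookup_const_part lookup_map_const_coeff
      by (auto simp: const_coeff_sum const_coeff_mult intro!: sum.cong dest: deg)
  next
    case False
    then show ?thesis
      unfolding R lookup_const_part lookup_map_const_coeff
      by (auto intro!: sum.neutral dest: deg)
  qed
qed

lemma subspace_ideal_forms: "ideal_in V I \<Longrightarrow> pm.subspace {f \<in> I. form j f}"
  by (auto simp: pm.subspace_def form_add form_scale intro: ideal_inD)

text \<open>
  The resolution need not be minimal, but its generators of degree less than \<open>j\<close> are mapped to \<open>0\<close> in
  \<open>I\<close>. Hence the degree \<open>j\<close> strand of \<open>F\<^sub>0 \<otimes> k\<close> maps onto \<open>I\<^sub>j\<close>, and the kernel consists of the boundaries.
\<close>

lemma betti_0_lowest_degree:
  fixes I :: "'k::field mpol set"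
  assumes V: "finite V" and I: "homogeneous_ideal V I"
    and low: "\<And>f d. f \<in> I \<Longrightarrow> form d f \<Longrightarrow> d < j \<Longrightarrow> f = 0"
  shows "betti V 0 j I = pm.dim {f \<in> I. form j f}"
proof -
  define F where "F = (SOME F. graded_free_resolution V I F)"
  have res: "graded_free_resolution V I F"
    unfolding F_def using graded_free_resolution_exists[OF V I] by (rule someI_ex)
  let ?B = "{b \<in> gens F 0. gdeg F 0 b = j}" and ?B1 = "{b \<in> gens F 1. gdeg F 1 b = j}"
  have finB: "finite ?B" using res by (auto simp: graded_free_resolution_def)
  have aug: "aug F b \<in> I" "form (gdeg F 0 b) (aug F b)" if "b \<in> gens F 0" for b
    using res that by (auto simp: graded_free_resolution_def)
  have aug_low: "aug F b = 0" if "b \<in> gens F 0" "gdeg F 0 b < j" for b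
    using aug[OF that(1)] low that(2) by blast
  have d1: "diff F 0 b \<in> free_module V (gens F 0)" "homogeneous_elt (gdeg F 0) (gdeg F 1 b) (diff F 0 b)"
    if "b \<in> gens F 1" for b
    using res that by (auto simp: graded_free_resolution_def)
  have surj: "aug_map F ` free_module V (gens F 0) = I"
    and ex: "{f \<in> free_module V (gens F 0). aug_map F f = 0} = lin_ext (diff F 0) ` free_module V (gens F 1)"
    using res by (auto simp: graded_free_resolution_def)
  define U where "U = tensor_strand F 0 j"
  have U: "U = {f. Poly_Mapping.keys f \<subseteq> ?B}" by (simp add: U_def tensor_strand_def)
  \<comment> \<open>Here \<open>lin_ext\<close> works over the ground field, a polynomial being
    itself a vector indexed by monomials; the scalars are the coordinates in the strand.\<close>
  let ?\<phi> = "lin_ext (aug F) :: (nat \<Rightarrow>\<^sub>0 'k) \<Rightarrow> 'k mpol"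
  \<comment> \<open>A generator of degree below \<open>j\<close> maps to 0, one of degree above
    \<open>j\<close> contributes nothing in degree \<open>j\<close>, and one of degree exactly
    \<open>j\<close> contributes through its constant coefficient.\<close>
  have \<phi>_const_part: "?\<phi> (const_part (gdeg F 0) j h) = hcomp j (aug_map F h)"
    if h: "h \<in> free_module V (gens F 0)" for h
  proof -
    have "Poly_Mapping.keys (const_part (gdeg F 0) j h) \<subseteq> Poly_Mapping.keys h"
      using keys_const_part[of "gdeg F 0" j h] by blast
    then have "?\<phi> (const_part (gdeg F 0) j h) = (\<Sum>b\<in>Poly_Mapping.keys h.
        pm_scale (Poly_Mapping.lookup (const_part (gdeg F 0) j h) b) (aug F b))"
      by (intro lin_ext_superset) simp_all
    also have "\<dots> = (\<Sum>b\<in>Poly_Mapping.keys h. hcomp j (Poly_Mapping.lookup h b * aug F b))"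
    proof (rule sum.cong)
      fix b assume "b \<in> Poly_Mapping.keys h"
      then have b: "b \<in> gens F 0" using h by (auto simp: free_module_def)
      consider "gdeg F 0 b < j" | "gdeg F 0 b = j" | "gdeg F 0 b > j" by linarith
      then show "pm_scale (Poly_Mapping.lookup (const_part (gdeg F 0) j h) b) (aug F b) =
          hcomp j (Poly_Mapping.lookup h b * aug F b)"
        by cases (simp_all add: hcomp_mult_form[OF aug(2)[OF b]] lookup_const_part aug_low[OF b]
            hcomp_zero_eq Const_mult)
    qed simp
    finally show ?thesis by (simp add: aug_map_def hcomp_sum)
  qed
  have Id: "ideal_in V I" using I by (simp add: homogeneous_ideal_def)
  have image: "?\<phi> ` U = {f \<in> I. form j f}"
  proof
    show "?\<phi> ` U \<subseteq> {f \<in> I. form j f}"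
      unfolding lin_ext_def U
      by (intro image_subsetI pm.subspace_sum pm.subspace_scale subspace_ideal_forms[OF Id])
        (use aug in blast)
    show "{f \<in> I. form j f} \<subseteq> ?\<phi> ` U"
    proof
      fix f assume f: "f \<in> {f \<in> I. form j f}"
      then obtain h where h: "h \<in> free_module V (gens F 0)" "f = aug_map F h" using surj by blast
      then have "?\<phi> (const_part (gdeg F 0) j h) = f"
        using f \<phi>_const_part[OF h(1)] by (simp add: form_iff_hcomp)
      moreover have "const_part (gdeg F 0) j h \<in> U"
        unfolding U using h(1) keys_const_part[of "gdeg F 0" j h] by (auto simp: free_module_def)
      ultimately show "f \<in> ?\<phi> ` U" by blast
    qed
  qed
  have td: "tensor_diff F 0 (const_part (gdeg F 1) j w) = const_part (gdeg F 0) j (lin_ext (diff F 0) w)"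
    if "w \<in> free_module V (gens F 1)" for w
    unfolding tensor_diff_def
    using that d1(2) by (intro const_part_lin_ext[symmetric]) (auto simp: free_module_def)
  have kernel: "{f \<in> U. ?\<phi> f = 0} = tensor_boundaries F 0 j"
  proof (intro equalityI subsetI)
    fix f assume f: "f \<in> {f \<in> U. ?\<phi> f = 0}"
    \<comment> \<open>Lifting \<open>f\<close> by constants gives an element killed by the
      augmentation. Exactness provides a preimage \<open>w\<close>, and the constant part of
      \<open>w\<close> has boundary \<open>f\<close>.\<close>
    let ?h = "Poly_Mapping.map Const f"
    have "?h \<in> free_module V (gens F 0)" using f by (intro free_module_map_Const) (auto simp: U)
    moreover have "aug_map F ?h = ?\<phi> f"
      unfolding lin_ext_def aug_map_def lookup_map_Const Const_mult
      using keys_map_Const[of f]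
      by (intro sum.mono_neutral_left) (auto simp: in_keys_iff lookup_map_Const Const_eq_0_iff)
    ultimately obtain w where w: "w \<in> free_module V (gens F 1)" "?h = lin_ext (diff F 0) w"
      using ex f by auto
    have "f = const_part (gdeg F 0) j ?h"
      using f by (intro const_part_map_Const[symmetric]) (auto simp: U)
    also have "\<dots> = tensor_diff F 0 (const_part (gdeg F 1) j w)" by (simp only: w td)
    finally have "f = tensor_diff F 0 (const_part (gdeg F 1) j w)" .
    moreover have "const_part (gdeg F 1) j w \<in> tensor_strand F (Suc 0) j"
      using w(1) keys_const_part[of "gdeg F 1" j w] by (auto simp: tensor_strand_def free_module_def)
    ultimately show "f \<in> tensor_boundaries F 0 j"
      unfolding tensor_boundaries_def by (rule image_eqI)
  next
    fix f assume "f \<in> tensor_boundaries F 0 j"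
    then obtain u where u: "f = tensor_diff F 0 u" "Poly_Mapping.keys u \<subseteq> ?B1"
      by (auto simp: tensor_boundaries_def tensor_strand_def)
    \<comment> \<open>Conversely, the lift of \<open>u\<close> maps to a syzygy of the augmentation,
      whose constant part is \<open>f\<close>.\<close>
    let ?w = "Poly_Mapping.map Const u"
    have w: "?w \<in> free_module V (gens F 1)" using u(2) by (intro free_module_map_Const) auto
    have "const_part (gdeg F 1) j ?w = u" using u(2) by (intro const_part_map_Const) auto
    then have f: "f = const_part (gdeg F 0) j (lin_ext (diff F 0) ?w)" using td[OF w] u(1) by simp
    have k: "lin_ext (diff F 0) ?w \<in> free_module V (gens F 0)" "aug_map F (lin_ext (diff F 0) ?w) = 0"
      using ex w by blast+
    have "f \<in> U"
      unfolding U f using k(1) keys_const_part[of "gdeg F 0" j] by (fastforce simp: free_module_def)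
    moreover have "?\<phi> f = 0" unfolding f \<phi>_const_part[OF k(1)] k(2) by simp
    ultimately show "f \<in> {f \<in> U. ?\<phi> f = 0}" by simp
  qed
  interpret vector_space_pair "pm_scale :: 'k \<Rightarrow> (nat \<Rightarrow>\<^sub>0 'k) \<Rightarrow> _" "pm_scale :: 'k \<Rightarrow> 'k mpol \<Rightarrow> _" ..
  let ?T = "(\<lambda>b. Poly_Mapping.single b (1::'k)) ` ?B"
  have "U \<subseteq> pm.span ?T"
  proof
    fix f assume f: "f \<in> U"
    have "(\<Sum>b\<in>Poly_Mapping.keys f. pm_scale (Poly_Mapping.lookup f b) (Poly_Mapping.single b 1)) \<in> pm.span ?T"
      using f unfolding U by (intro pm.span_sum pm.span_scale pm.span_base imageI) auto
    then show "f \<in> pm.span ?T"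
      by (simp add: pm_scale_single flip: poly_mapping_sum_singles)
  qed
  moreover have "pm.subspace U"
    unfolding U pm.subspace_def
    by (auto dest!: subsetD[OF keys_add] subsetD[OF keys_pm_scale] del: subsetI intro!: subsetI)
  ultimately have "pm.dim U = pm.dim {f \<in> U. ?\<phi> f = 0} + pm.dim (?\<phi> ` U)"
    using finB by (intro rank_nullity_subspace[of _ _ ?T]) (auto intro: linear_lin_ext)
  \<comment> \<open>In homological degree 0 the whole strand \<open>U\<close> consists of cycles, so
    cycles minus boundaries is the dimension of the image.\<close>
  then show ?thesis
    unfolding image kernel
    by (simp add: betti_def tor_dim_def Let_def tensor_cycles_def U_def flip: F_def)
qed

section \<open>Dehomogenization\<close>

lemma single_eq_0_iff: "Poly_Mapping.single k c = 0 \<longleftrightarrow> c = 0"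
  by (metis lookup_single_eq lookup_zero single_zero)

lemma keys_nonempty: "m \<noteq> 0 \<Longrightarrow> \<exists>i. i \<in> Poly_Mapping.keys m"
  by (metis in_keys_iff lookup_zero poly_mapping_eqI)

lemma const_coeff_scale: "const_coeff (pm_scale c p) = c * const_coeff p"
  by (simp add: const_coeff_def lookup_pm_scale)

lemma dehom_superset:
  assumes "finite A" "Poly_Mapping.keys p \<subseteq> A"
  shows "dehom i p = (\<Sum>m\<in>A. Poly_Mapping.single (drop_var i m) (Poly_Mapping.lookup p m))"
  unfolding dehom_eq using assms by (intro sum.mono_neutral_left) (auto simp: in_keys_iff)

lemma dehom_0 [simp]: "dehom i 0 = 0"
  by (simp add: dehom_eq)

lemma dehom_single: "dehom i (Poly_Mapping.single m c) = Poly_Mapping.single (drop_var i m) c"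
  by (subst dehom_superset[of "{m}"]) auto

lemma dehom_add: "dehom i (p + q) = dehom i p + dehom i q"
proof -
  let ?A = "Poly_Mapping.keys p \<union> Poly_Mapping.keys q"
  have A: "finite ?A" "Poly_Mapping.keys (p + q) \<subseteq> ?A" "Poly_Mapping.keys p \<subseteq> ?A" "Poly_Mapping.keys q \<subseteq> ?A"
    using keys_add[of p q] by auto
  show ?thesis
    unfolding A(2-4)[THEN dehom_superset[OF A(1)]] by (simp add: lookup_add single_add sum.distrib)
qed

lemma drop_var_add: "drop_var i (m + m') = drop_var i m + drop_var i m'"
  by (rule poly_mapping_eqI) (simp add: lookup_drop_var lookup_add)

lemma drop_var_id: "i \<notin> Poly_Mapping.keys m \<Longrightarrow> drop_var i m = m"
  by (rule poly_mapping_eqI) (auto simp: lookup_drop_var in_keys_iff)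

lemma dehom_mult: "dehom i (p * q) = dehom i p * dehom i q"
proof (induction p rule: poly_mapping_induct)
  case (single m c)
  show ?case
    by (induction q rule: poly_mapping_induct)
      (simp_all add: mult_single dehom_single drop_var_add distrib_left dehom_add)
qed (simp_all add: distrib_right dehom_add)

lemma drop_var_0 [simp]: "drop_var i 0 = 0"
  by (simp add: drop_var_id)

lemma dehom_Const [simp]: "dehom i (Const c) = Const c"
  by (simp add: Const_def dehom_single)

lemma dehom_scale: "dehom i (pm_scale c p) = pm_scale c (dehom i p)"
  by (metis Const_mult dehom_Const dehom_mult)

lemma dehom_Var_power: "dehom i (Var i ^ n) = 1"
proof -
  have "drop_var i (Poly_Mapping.single i n) = 0"
    by (rule poly_mapping_eqI) (simp add: lookup_drop_var lookup_single when_def)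
  then show ?thesis by (simp add: Var_power dehom_single)
qed

lemma dehom_id: "p \<in> polys V \<Longrightarrow> i \<notin> V \<Longrightarrow> dehom i p = p"
proof -
  assume *: "p \<in> polys V" "i \<notin> V"
  have "dehom i p = (\<Sum>m\<in>Poly_Mapping.keys p. Poly_Mapping.single m (Poly_Mapping.lookup p m))"
    unfolding dehom_eq
  proof (rule sum.cong)
    fix m assume "m \<in> Poly_Mapping.keys p"
    then have "i \<notin> Poly_Mapping.keys m" using * by (auto simp: polys_def)
    then show "Poly_Mapping.single (drop_var i m) (Poly_Mapping.lookup p m) = Poly_Mapping.single m (Poly_Mapping.lookup p m)"
      by (simp add: drop_var_id)
  qed simp
  then show ?thesis by (simp flip: poly_mapping_sum_singles)
qed

text \<open>On monomials of one degree \<open>drop_var\<close> is injective, so dehomogenization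
  merges no coefficients. Here \<open>m\<close> may also be absent from \<open>p\<close>, which is
  needed to conclude that a coefficient of \<open>p\<close> vanishes.\<close>

lemma lookup_dehom_drop_var:
  assumes p: "form d p" and m: "mdeg m = d"
  shows "Poly_Mapping.lookup (dehom i p) (drop_var i m) = Poly_Mapping.lookup p m"
proof -
  have *: "drop_var i m' = drop_var i m \<longleftrightarrow> m' = m" if "m' \<in> Poly_Mapping.keys p" for m'
    using that p m drop_var_inj[of m' m i] by (auto simp: form_def)
  have "Poly_Mapping.lookup (dehom i p) (drop_var i m) =
      (\<Sum>m'\<in>Poly_Mapping.keys p. if m' = m then Poly_Mapping.lookup p m' else 0)"
    unfolding dehom_eq lookup_sum lookup_single when_def by (rule sum.cong) (simp_all add: *)
  then show ?thesis by (simp add: in_keys_iff)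
qed

lemma lookup_single_mult:
  "Poly_Mapping.lookup (Poly_Mapping.single k c * p) (k + m) = c * Poly_Mapping.lookup p m"
  for p :: "'k::field mpol"
proof (induction p rule: poly_mapping_induct)
  case (single m' c')
  show ?case by (auto simp: mult_single lookup_single when_def)
qed (simp_all add: distrib_left lookup_add)

lemma keys_single_mult:
  "Poly_Mapping.keys (Poly_Mapping.single k c * p) \<subseteq> (+) k ` Poly_Mapping.keys p"
  for p :: "'k::field mpol"
  using keys_mult[of "Poly_Mapping.single k c" p] by (auto split: if_splits)

lemma exponent_split:
  assumes "n \<le> Poly_Mapping.lookup m i"
  shows "Poly_Mapping.single i n + (m - Poly_Mapping.single i n) = (m :: nat \<Rightarrow>\<^sub>0 nat)"
  using assms by (intro poly_mapping_eqI) (auto simp: lookup_add lookup_minus lookup_single when_def)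

section \<open>Sections of twisted ideal sheaves\<close>

text \<open>Each monomial is divided by the power of the variable; the degree of the quotient
  follows by cancellation.\<close>

lemma Var_power_factor:
  fixes f :: "'k::field mpol"
  assumes f: "f \<in> polys V" "form (d + n) f" and n: "\<And>m. m \<in> Poly_Mapping.keys f \<Longrightarrow> n \<le> Poly_Mapping.lookup m i"
  obtains h where "h \<in> polys V" "form d h" "f = Var i ^ n * h"
proof
  let ?h = "\<Sum>m\<in>Poly_Mapping.keys f. Poly_Mapping.single (m - Poly_Mapping.single i n) (Poly_Mapping.lookup f m)"
  have "Var i ^ n * ?h = (\<Sum>m\<in>Poly_Mapping.keys f. Poly_Mapping.single m (Poly_Mapping.lookup f m))"
    unfolding Var_power sum_distrib_left
    by (rule sum.cong) (simp_all add: mult_single exponent_split n)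
  then show fh: "f = Var i ^ n * ?h" by (simp flip: poly_mapping_sum_singles)
  have "Poly_Mapping.keys (m - Poly_Mapping.single i n) \<subseteq> Poly_Mapping.keys m" for m :: "nat \<Rightarrow>\<^sub>0 nat"
    by (auto simp: in_keys_iff lookup_minus)
  then show "?h \<in> polys V"
    using f(1) by (intro polys_sum polys_single) (fastforce simp: polys_def)
  have "form n (Var i ^ n :: 'k mpol)" "(Var i ^ n :: 'k mpol) \<noteq> 0"
    by (simp_all add: Var_power form_single single_eq_0_iff)
  then show "form d ?h"
    using form_mult_cancel_left[of n "Var i ^ n" "d + n" ?h] f(2) fh by simp
qed

text \<open>A section has a denominator in a single variable on each chart. Comparing two charts
  shows that the denominator divides the numerator, so the section is a polynomial form.\<close>

lemma global_sections_eq: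
  fixes X :: "'k::field subscheme"
  assumes "V \<noteq> {}"
  shows "global_sections V X d =
    (\<lambda>f. Fract f 1) ` {f \<in> polys V. form d f \<and> (\<forall>i\<in>V. dehom i f \<in> X i)}"
proof (intro equalityI subsetI)
  fix z assume z: "z \<in> global_sections V X d"
  have *: "\<exists>h. h \<in> polys V \<and> form d h \<and> dehom i h \<in> X i \<and> z = Fract h 1" if i: "i \<in> V" for i
  proof -
    have ch: "\<And>j. j \<in> V \<Longrightarrow> \<exists>f m. z = Fract f (Var j ^ m) \<and> f \<in> polys V \<and> form (d + m) f \<and> dehom j f \<in> X j"
      using z by (auto simp: global_sections_def chart_sections_def)
    obtain f n where f: "z = Fract f (Var i ^ n)" "f \<in> polys V" "form (d + n) f" "dehom i f \<in> X i"
      using ch[OF i] by blast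
    have nz: "(Var j ^ l :: 'k mpol) \<noteq> 0" for j l by (simp add: Var_power single_eq_0_iff)
    have "n \<le> Poly_Mapping.lookup m i" if m: "m \<in> Poly_Mapping.keys f" for m
    proof (cases "V = {i}")
      case True
      \<comment> \<open>With a single coordinate there is no second chart, but then the exponent of
        \<open>x_i\<close> is the full degree \<open>d + n\<close>.\<close>
      then have "Poly_Mapping.keys m \<subseteq> {i}" using f(2) m by (auto simp: polys_def)
      then have "mdeg m = Poly_Mapping.lookup m i" using mdeg_superset[of "{i}" m] by simp
      then show ?thesis using f(3) m by (auto simp: form_def)
    next
      case False
      then obtain j where j: "j \<in> V" "j \<noteq> i" using i by blast
      obtain g l where g: "z = Fract g (Var j ^ l)" using ch[OF j(1)] by blast
      \<comment> \<open>After clearing denominators, \<open>x_i^n\<close> divides every monomial of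
        \<open>x_j^l * f\<close>; as \<open>j\<close> differs from \<open>i\<close>, the factor
        comes from \<open>f\<close>.\<close>
      have "Var j ^ l * f = Var i ^ n * g"
        using f(1) g eq_fract(1)[OF nz nz, of f i n g j l] by (simp add: mult.commute)
      moreover have "Poly_Mapping.single j l + m \<in> Poly_Mapping.keys (Var j ^ l * f)"
        using m by (simp add: Var_power in_keys_iff lookup_single_mult)
      ultimately have "Poly_Mapping.single j l + m \<in> (+) (Poly_Mapping.single i n) ` Poly_Mapping.keys g"
        using keys_single_mult[of "Poly_Mapping.single i n" 1 g] by (auto simp: Var_power)
      then obtain m' where "Poly_Mapping.single j l + m = Poly_Mapping.single i n + m'" by blast
      then have "Poly_Mapping.lookup (Poly_Mapping.single j l + m) i =
          Poly_Mapping.lookup (Poly_Mapping.single i n + m') i" by simp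
      then show ?thesis using j(2) by (simp add: lookup_add lookup_single when_def)
    qed
    then obtain h where h: "h \<in> polys V" "form d h" "f = Var i ^ n * h"
      using Var_power_factor[OF f(2,3)] by blast
    have "z = Fract h 1" using f(1) h(3) nz[of i n] by (simp add: eq_fract(1)[OF nz])
    moreover have "dehom i h \<in> X i" using f(4) h(3) by (simp add: dehom_mult dehom_Var_power)
    ultimately show ?thesis using h by blast
  qed
  obtain i where "i \<in> V" using assms by blast
  then obtain h where h: "h \<in> polys V" "form d h" "z = Fract h 1" using * by blast
  \<comment> \<open>The polynomials found on different charts represent the same fraction over 1 and
    therefore coincide.\<close>
  have "dehom j h \<in> X j" if j: "j \<in> V" for j
    using *[OF j] h(3) by (auto simp: eq_fract(1))
  then show "z \<in> (\<lambda>f. Fract f 1) ` {f \<in> polys V. form d f \<and> (\<forall>i\<in>V. dehom i f \<in> X i)}"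
    using h by blast
next
  fix z assume "z \<in> (\<lambda>f. Fract f 1) ` {f \<in> polys V. form d f \<and> (\<forall>i\<in>V. dehom i f \<in> X i)}"
  then obtain f where f: "z = Fract f 1" "f \<in> polys V" "form d f" "\<forall>i\<in>V. dehom i f \<in> X i" by blast
  then have "z \<in> chart_sections V X d i" if "i \<in> V" for i
    unfolding chart_sections_def using that by (intro CollectI exI[of _ f] exI[of _ 0]) simp
  then show "z \<in> global_sections V X d" by (simp add: global_sections_def)
qed

text \<open>Polynomials embed linearly and injectively into the fraction field, which reduces
  \<open>h0\<close> to a dimension of a space of forms.\<close>

lemma h0_eq_dim:
  fixes X :: "'k::field subscheme"
  assumes "finite V" "V \<noteq> {}" and W: "{f \<in> polys V. form d f \<and> (\<forall>i\<in>V. dehom i f \<in> X i)} = W"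
    and "pm.subspace W"
  shows "h0 V X d = pm.dim W"
proof -
  interpret vector_space_pair "pm_scale :: 'k \<Rightarrow> 'k mpol \<Rightarrow> _" "fract_scale :: 'k \<Rightarrow> 'k mpol fract \<Rightarrow> _" ..
  have "Vector_Spaces.linear pm_scale fract_scale (\<lambda>f :: 'k mpol. Fract f 1)"
    by (simp add: Vector_Spaces.linear_iff fract_scale_def Const_mult pm.vector_space_axioms fr.vector_space_axioms)
  then have "fr.dim ((\<lambda>f. Fract f 1) ` W) = pm.dim W"
    using forms_subset_span[of V d] W finite_monomials[OF assms(1), of d] assms(4)
    by (intro dim_image_inj_on[where T = "(\<lambda>m. Poly_Mapping.single m 1) ` {m. Poly_Mapping.keys m \<subseteq> V \<and> mdeg m = d}"])
      (auto simp: Zero_fract_def eq_fract)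
  then show ?thesis by (simp add: h0_def global_sections_eq[OF assms(2)] W)
qed

section \<open>The tangent space of an affine scheme at the origin\<close>

lemma sum_fun_apply: "(\<Sum>x\<in>A. f x) y = (\<Sum>x\<in>A. f x y)"
  by (induction A rule: infinite_finite_induct) auto

text \<open>The coordinates are constrained on \<open>W\<close> only because
  \<open>coord_point 0\<close> has the entry 1 at the index 0, outside the variables of its
  chart.\<close>

lemma eval_at_origin:
  assumes "p \<in> polys W" "\<And>i. i \<in> W \<Longrightarrow> a i = 0"
  shows "eval_at a p = const_coeff p"
proof -
  have *: "(\<Prod>j\<in>Poly_Mapping.keys m. a j ^ Poly_Mapping.lookup m j) = (if m = 0 then 1 else 0)"
    if m: "m \<in> Poly_Mapping.keys p" for m
  proof (cases "m = 0")
    case False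
    then obtain j where j: "j \<in> Poly_Mapping.keys m" using keys_nonempty by blast
    moreover have "j \<in> W" using assms(1) m j by (auto simp: polys_def)
    ultimately have "a j ^ Poly_Mapping.lookup m j = 0"
      using assms(2) by (simp add: in_keys_iff)
    then show ?thesis using j False by (auto simp: prod_zero_iff)
  qed simp
  have "eval_at a p = (\<Sum>m\<in>Poly_Mapping.keys p. if m = 0 then Poly_Mapping.lookup p m else 0)"
    unfolding eval_at_def subst_poly_def by (rule sum.cong) (auto simp: *)
  then show ?thesis by (simp add: const_coeff_def in_keys_iff)
qed

lemma affine_tangent_space_sum:
  assumes \<psi>: "\<psi> \<in> affine_tangent_space W A a" and M: "M = max_ideal W a" "M = {f \<in> polys W. const_coeff f = 0}"
    and g: "\<And>x. x \<in> S \<Longrightarrow> g x \<in> M"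
  shows "\<psi> (\<Sum>x\<in>S. pm_scale (c x) (g x)) = (\<Sum>x\<in>S. c x * \<psi> (g x))"
  using g
proof (induction S rule: infinite_finite_induct)
  case (insert x S)
  have M': "(\<Sum>x\<in>S. pm_scale (c x) (g x)) \<in> M" "pm_scale (c x) (g x) \<in> M"
    using insert.prems unfolding M(2)
    by (auto simp: const_coeff_sum const_coeff_scale intro!: polys_sum polys_scale)
  have "\<psi> (pm_scale (c x) (g x)) = c x * \<psi> (g x)"
    using \<psi> insert.prems unfolding affine_tangent_space_def Let_def M(1)[symmetric] by (auto simp: Const_mult)
  moreover have "\<psi> (pm_scale (c x) (g x) + (\<Sum>x\<in>S. pm_scale (c x) (g x))) =
      \<psi> (pm_scale (c x) (g x)) + \<psi> (\<Sum>x\<in>S. pm_scale (c x) (g x))"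
    using \<psi> M' unfolding affine_tangent_space_def Let_def M(1)[symmetric] by blast
  ultimately show ?case using insert by simp
qed (use \<psi> M in \<open>auto simp: affine_tangent_space_def Let_def Const_mult dest!: spec[of _ 0]\<close>)

text \<open>A monomial of degree at least 2 is a variable times a nonconstant monomial, that is a
  product of two elements of \<open>M\<close>, and \<open>\<psi>\<close> kills such
  products.\<close>

lemma affine_tangent_space_linear_part:
  assumes \<psi>: "\<psi> \<in> affine_tangent_space W A a" and M: "M = max_ideal W a" "M = {f \<in> polys W. const_coeff f = 0}"
    and f: "f \<in> M"
  shows "\<psi> f = \<psi> (hcomp 1 f)"
proof -
  have one: "Poly_Mapping.single m 1 \<in> M" if "m \<in> Poly_Mapping.keys f" for m
    using that f unfolding M(2) by (auto simp: polys_def const_coeff_def lookup_single when_def in_keys_iff)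
  have van: "\<psi> (Poly_Mapping.single m 1) = 0" if m: "m \<in> Poly_Mapping.keys f" "mdeg m \<noteq> 1" for m
  proof -
    have "m \<noteq> 0" using m(1) f unfolding M(2) by (auto simp: const_coeff_def in_keys_iff)
    then obtain i where i: "i \<in> Poly_Mapping.keys m" using keys_nonempty by blast
    define r where "r = m - Poly_Mapping.single i 1"
    have mr: "m = Poly_Mapping.single i 1 + r"
      using i unfolding r_def by (intro exponent_split[symmetric]) (simp add: in_keys_iff Suc_le_eq)
    then have "r \<noteq> 0" using m(2) by (auto simp: mdeg_add)
    have "Poly_Mapping.keys r \<subseteq> Poly_Mapping.keys m"
      by (auto simp: r_def in_keys_iff lookup_minus)
    moreover have "Poly_Mapping.keys m \<subseteq> W" using m(1) f unfolding M(2) by (auto simp: polys_def)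
    ultimately have "Poly_Mapping.single (Poly_Mapping.single i 1) 1 \<in> M" "Poly_Mapping.single r 1 \<in> M"
      using i \<open>r \<noteq> 0\<close> unfolding M(2)
      by (auto simp: polys_def const_coeff_def lookup_single when_def dest: arg_cong[where f = Poly_Mapping.keys])
    moreover have "\<And>f g. f \<in> M \<Longrightarrow> g \<in> M \<Longrightarrow> \<psi> (f * g) = 0"
      using \<psi> unfolding affine_tangent_space_def Let_def M(1)[symmetric] by blast
    ultimately have "\<psi> (Poly_Mapping.single (Poly_Mapping.single i 1) 1 * Poly_Mapping.single r 1) = 0" by blast
    then show ?thesis by (subst mr) (simp add: mult_single)
  qed
  have "\<psi> f = \<psi> (\<Sum>m\<in>Poly_Mapping.keys f. pm_scale (Poly_Mapping.lookup f m) (Poly_Mapping.single m 1))"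
    by (simp add: pm_scale_single flip: poly_mapping_sum_singles)
  also have "\<dots> = (\<Sum>m\<in>Poly_Mapping.keys f. Poly_Mapping.lookup f m * \<psi> (Poly_Mapping.single m 1))"
    by (rule affine_tangent_space_sum[OF \<psi> M one])
  also have "\<dots> = (\<Sum>m\<in>Poly_Mapping.keys f. (if mdeg m = 1 then Poly_Mapping.lookup f m else 0) * \<psi> (Poly_Mapping.single m 1))"
    by (rule sum.cong) (auto simp: van)
  also have "\<dots> = \<psi> (\<Sum>m\<in>Poly_Mapping.keys f. pm_scale (if mdeg m = 1 then Poly_Mapping.lookup f m else 0) (Poly_Mapping.single m 1))"
    by (rule affine_tangent_space_sum[OF \<psi> M one, symmetric])
  also have "(\<Sum>m\<in>Poly_Mapping.keys f. pm_scale (if mdeg m = 1 then Poly_Mapping.lookup f m else 0) (Poly_Mapping.single m 1)) = hcomp 1 f"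
  proof (rule poly_mapping_eqI)
    fix k
    have "Poly_Mapping.lookup (\<Sum>m\<in>Poly_Mapping.keys f. pm_scale (if mdeg m = 1 then Poly_Mapping.lookup f m else 0) (Poly_Mapping.single m 1)) k =
        (\<Sum>m\<in>Poly_Mapping.keys f. if m = k then Poly_Mapping.lookup (hcomp 1 f) k else 0)"
      unfolding lookup_sum lookup_pm_scale
      by (rule sum.cong) (auto simp: lookup_single when_def lookup_hcomp)
    also have "\<dots> = Poly_Mapping.lookup (hcomp 1 f) k"
      by (simp add: in_keys_iff lookup_hcomp)
    finally show "Poly_Mapping.lookup (\<Sum>m\<in>Poly_Mapping.keys f. pm_scale (if mdeg m = 1 then Poly_Mapping.lookup f m else 0) (Poly_Mapping.single m 1)) k =
        Poly_Mapping.lookup (hcomp 1 f) k" .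
  qed
  finally show ?thesis .
qed

text \<open>The tangent space is dual to the linear forms modulo the linear parts of
  \<open>A\<close>. With a basis \<open>C\<close> of these linear parts extended to a basis
  \<open>B\<close> of all linear forms, the coordinates belonging to \<open>B - C\<close> form a
  basis of it.\<close>

lemma dim_affine_tangent_space:
  fixes A :: "'k::field mpol set"
  assumes W: "finite W" and a: "\<And>i. i \<in> W \<Longrightarrow> a i = 0"
    and A: "\<And>f. f \<in> A \<Longrightarrow> f \<in> polys W \<and> const_coeff f = 0" and L: "pm.subspace (hcomp 1 ` A)"
  shows "fn.dim (affine_tangent_space W A a) + pm.dim (hcomp 1 ` A) = card W"
proof -
  let ?T = "affine_tangent_space W A a"
  define M where M: "M = max_ideal W a"
  have M': "M = {f \<in> polys W. const_coeff f = 0}"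
    unfolding M max_ideal_def using eval_at_origin[of _ W a, OF _ a] by auto
  let ?S = "{f :: 'k mpol. f \<in> polys W \<and> form 1 f}"
  have lin: "hcomp 1 f \<in> ?S" if "f \<in> M" for f
    using that form_hcomp polys_hcomp unfolding M' by blast
  have SM: "f \<in> M" if "f \<in> ?S" for f
    using that const_coeff_form[of 1 f] unfolding M' by auto
  have AM: "A \<subseteq> M" using A unfolding M' by blast
  have LS: "hcomp 1 ` A \<subseteq> ?S" using lin AM by blast
  have fin: "finite ((\<lambda>m. Poly_Mapping.single m (1::'k)) ` {m. Poly_Mapping.keys m \<subseteq> W \<and> mdeg m = 1})"
    using finite_monomials[OF W] by blast
  obtain C where C: "C \<subseteq> hcomp 1 ` A" "pm.independent C" "hcomp 1 ` A \<subseteq> pm.span C"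
    "card C = pm.dim (hcomp 1 ` A)"
    by (rule pm.basis_exists)
  obtain B where B: "C \<subseteq> B" "B \<subseteq> ?S" "pm.independent B" "?S \<subseteq> pm.span B"
    using pm.maximal_independent_subset_extend[of C ?S] C(1,2) LS by blast
  have finB: "finite B"
    using pm.independent_span_bound[OF fin B(3)] B(2) forms_subset_span[of W 1] by blast
  have "card B = pm.dim ?S" using B by (intro pm.basis_card_eq_dim) auto
  also have "\<dots> = card W"
  proof -
    have "{m. Poly_Mapping.keys m \<subseteq> W \<and> mdeg m = 1} = (\<lambda>i. Poly_Mapping.single i 1) ` W"
      by (auto simp: mdeg_eq_1_iff simp del: One_nat_def)
    moreover have "inj_on (\<lambda>i. Poly_Mapping.single i (1::nat)) W"
      by (rule inj_onI, drule arg_cong[where f = Poly_Mapping.keys]) simp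
    ultimately show ?thesis unfolding dim_forms by (simp add: card_image)
  qed
  finally have cardB: "card B = card W" .
  \<comment> \<open>The \<open>b\<close>-th coordinate of the linear part, extended by zero outside
    \<open>M\<close> as \<open>affine_tangent_space\<close> prescribes.\<close>
  define \<phi> where "\<phi> b f = (if f \<in> M then pm.representation B (hcomp 1 f) b else 0)" for b f
  let ?D = "B - C"
  have \<phi>B: "\<phi> b b' = (if b = b' then 1 else 0)" if "b' \<in> B" for b b'
  proof -
    have "b' \<in> ?S" using that B(2) by blast
    then show ?thesis
      using SM[of b'] pm.representation_basis[OF B(3) that] by (auto simp: \<phi>_def form_iff_hcomp)
  qed
  have MT: "\<phi> b \<in> ?T" if b: "b \<in> ?D" for b
    unfolding affine_tangent_space_def Let_def M[symmetric]
  proof (intro CollectI conjI ballI allI impI)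
    show "\<phi> b f = 0" if "f \<notin> M" for f using that by (simp add: \<phi>_def)
    show "\<phi> b (f + g) = \<phi> b f + \<phi> b g" if "f \<in> M" "g \<in> M" for f g
    proof -
      have "f + g \<in> M" using that unfolding M' by (auto simp: polys_add const_coeff_add)
      moreover have "hcomp 1 f \<in> pm.span B" "hcomp 1 g \<in> pm.span B" using lin that B(4) by blast+
      ultimately show ?thesis
        using that by (simp add: \<phi>_def hcomp_add pm.representation_add[OF B(3)] del: One_nat_def)
    qed
    show "\<phi> b (Const c * f) = c * \<phi> b f" if "f \<in> M" for c f
    proof -
      have "pm_scale c f \<in> M" using that unfolding M' by (auto simp: polys_scale const_coeff_scale)
      moreover have "hcomp 1 f \<in> pm.span B" using lin that B(4) by blast
      ultimately show ?thesis
        using that by (simp add: \<phi>_def Const_mult hcomp_scale pm.representation_scale[OF B(3)] del: One_nat_def)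
    qed
    show "\<phi> b (f * g) = 0" if "f \<in> M" "g \<in> M" for f g
    proof -
      have "hcomp 1 (f * g) = 0" using that unfolding M' by (simp add: hcomp_1_mult del: One_nat_def)
      then show ?thesis by (simp add: \<phi>_def pm.representation_zero)
    qed
    show "\<phi> b f = 0" if "f \<in> A" for f
    proof -
      \<comment> \<open>Linear parts of equations only have coordinates along \<open>C\<close>, and
        \<open>b\<close> lies outside \<open>C\<close>.\<close>
      have "hcomp 1 f \<in> pm.span C" using that C(3) by blast
      then have "pm.representation B (hcomp 1 f) = pm.representation C (hcomp 1 f)"
        by (rule pm.representation_extend[OF B(3) _ B(1)])
      then show ?thesis
        using b pm.representation_ne_zero[of C "hcomp 1 f" b] by (auto simp: \<phi>_def)
    qed
  qed
  have inj: "inj_on \<phi> ?D"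
    by (rule inj_onI) (metis \<phi>B DiffD1 zero_neq_one)
  have "fn.dim ?T = card ?D"
  proof (rule fn.dim_unique[of "\<phi> ` ?D"])
    show "\<phi> ` ?D \<subseteq> ?T" using MT by blast
    show "card (\<phi> ` ?D) = card ?D" by (rule card_image[OF inj])
    show "fn.independent (\<phi> ` ?D)"
    proof (rule fn.independent_if_scalars_zero)
      fix c x assume 0: "(\<Sum>x\<in>\<phi> ` ?D. fn_scale (c x) x) = 0" and "x \<in> \<phi> ` ?D"
      then obtain b where b: "x = \<phi> b" "b \<in> ?D" by blast
      \<comment> \<open>Evaluation at the basis vector \<open>b\<close> isolates its scalar, the
        functionals being dual to the basis.\<close>
      have "0 = (\<Sum>x\<in>\<phi> ` ?D. fn_scale (c x) x) b" by (simp add: 0)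
      also have "\<dots> = (\<Sum>b'\<in>?D. c (\<phi> b') * \<phi> b' b)"
        by (simp add: sum.reindex[OF inj] sum_fun_apply fn_scale_def)
      also have "\<dots> = (\<Sum>b'\<in>?D. if b' = b then c (\<phi> b') else 0)"
        by (rule sum.cong) (use b \<phi>B in auto)
      also have "\<dots> = c x" using b finB by simp
      finally show "c x = 0" ..
    qed (use finB in simp)
    show "?T \<subseteq> fn.span (\<phi> ` ?D)"
    proof
      fix \<psi> assume \<psi>: "\<psi> \<in> ?T"
      have \<psi>C: "\<psi> b = 0" if b: "b \<in> C" for b
      proof -
        obtain f where f: "f \<in> A" "b = hcomp 1 f" using C(1) b by blast
        then have "\<psi> f = 0" using \<psi> by (simp add: affine_tangent_space_def Let_def)
        then show ?thesis using affine_tangent_space_linear_part[OF \<psi> M M'] f AM by auto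
      qed
      \<comment> \<open>A tangent vector is determined by its values on \<open>B\<close>, and those
        on \<open>C\<close> vanish.\<close>
      have "\<psi> = (\<Sum>b\<in>?D. fn_scale (\<psi> b) (\<phi> b))"
      proof
        fix f
        show "\<psi> f = (\<Sum>b\<in>?D. fn_scale (\<psi> b) (\<phi> b)) f"
        proof (cases "f \<in> M")
          case True
          let ?r = "pm.representation B (hcomp 1 f)"
          have "hcomp 1 f = (\<Sum>b\<in>B. pm_scale (?r b) b)"
            using pm.sum_representation_eq[OF B(3) _ finB order.refl, of "hcomp 1 f"] lin[OF True] B(4) by auto
          then have "\<psi> f = \<psi> (\<Sum>b\<in>B. pm_scale (?r b) b)"
            using affine_tangent_space_linear_part[OF \<psi> M M' True] by simp
          also have "\<dots> = (\<Sum>b\<in>B. ?r b * \<psi> b)"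
            using B(2) SM by (intro affine_tangent_space_sum[OF \<psi> M M']) blast
          also have "\<dots> = (\<Sum>b\<in>?D. ?r b * \<psi> b)"
            using finB \<psi>C by (intro sum.mono_neutral_right) auto
          finally show ?thesis
            using True by (simp add: sum_fun_apply fn_scale_def \<phi>_def mult.commute)
        next
          case False
          then have "\<psi> f = 0" using \<psi> unfolding affine_tangent_space_def Let_def M[symmetric] by blast
          then show ?thesis using False by (simp add: sum_fun_apply fn_scale_def \<phi>_def)
        qed
      qed
      moreover have "(\<Sum>b\<in>?D. fn_scale (\<psi> b) (\<phi> b)) \<in> fn.span (\<phi> ` ?D)"
        by (intro fn.span_sum fn.span_scale fn.span_base imageI)
      ultimately show "\<psi> \<in> fn.span (\<phi> ` ?D)" by simp
    qed
  qed
  then show ?thesis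
    using finB B(1) C(4) cardB card_mono[OF finB B(1)] by (simp add: card_Diff_subset finite_subset)
qed

section \<open>Inner projection\<close>

lemma linear_linear_part:
  "Vector_Spaces.linear pm_scale pm_scale (\<lambda>f :: 'k::field mpol. hcomp 1 (dehom i f))"
  by (simp add: Vector_Spaces.linear_iff dehom_add dehom_scale hcomp_add hcomp_scale pm.vector_space_axioms)

text \<open>Vanishing at the coordinate point excludes the term \<open>x_i^2\<close>.
  Dehomogenization turns the terms \<open>x_i x_j\<close> into linear terms and leaves terms free of
  \<open>x_i\<close> in degree 2, so \<open>l\<close> is exactly the coefficient of
  \<open>x_i\<close>.\<close>

lemma quadric_decomposition:
  fixes F :: "'k::field mpol" and i V
  defines "l \<equiv> hcomp 1 (dehom i F)"
  assumes F: "F \<in> polys V" "form 2 F" "const_coeff (dehom i F) = 0" and i: "i \<in> V"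
  shows "l \<in> polys (V - {i})" "F - Var i * l \<in> polys (V - {i})"
proof -
  have l: "dehom i F \<in> polys (V - {i})" using dehom_in_polys_iff[OF F(2) i] F(1) by blast
  then show lp: "l \<in> polys (V - {i})" unfolding l_def by (rule polys_hcomp)
  show "F - Var i * l \<in> polys (V - {i})"
    unfolding polys_def
  proof (intro CollectI ballI)
    fix m assume m: "m \<in> Poly_Mapping.keys (F - Var i * l)"
    have "Poly_Mapping.lookup m i = 0"
    proof (rule ccontr)
      assume mi: "Poly_Mapping.lookup m i \<noteq> 0"
      define m' where "m' = m - Poly_Mapping.single i 1"
      have mm: "m = Poly_Mapping.single i 1 + m'"
        unfolding m'_def by (rule exponent_split[symmetric]) (use mi in simp)
      have lm: "Poly_Mapping.lookup (Var i * l) m = Poly_Mapping.lookup l m'"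
        unfolding Var_def mm lookup_single_mult by simp
      have "Poly_Mapping.lookup F m = Poly_Mapping.lookup l m'"
      proof (cases "mdeg m = 2")
        case False
        then have "Poly_Mapping.lookup F m = 0" using F(2) by (auto simp: form_def in_keys_iff)
        moreover have "mdeg m' \<noteq> 1" using False mm by (auto simp: mdeg_add)
        ultimately show ?thesis by (simp add: l_def lookup_hcomp)
      next
        case True
        then have "mdeg m' = 1" using mm mdeg_add[of "Poly_Mapping.single i 1" m'] by simp
        then obtain j where j: "m' = Poly_Mapping.single j 1" using mdeg_eq_1_iff by blast
        show ?thesis
        proof (cases "j = i")
          case False
          then have "drop_var i m = m'"
            unfolding mm j by (intro poly_mapping_eqI) (auto simp: lookup_drop_var lookup_add lookup_single when_def)
          then show ?thesis
            using lookup_dehom_drop_var[OF F(2) True, of i] \<open>mdeg m' = 1\<close> by (simp add: l_def lookup_hcomp)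
        next
          case True
          \<comment> \<open>Here \<open>m\<close> is the exponent of \<open>x_i^2\<close>, which
            dehomogenizes to the constant term.\<close>
          have "drop_var i m = 0"
            unfolding mm j True by (intro poly_mapping_eqI) (auto simp: lookup_drop_var lookup_add lookup_single when_def)
          then have "Poly_Mapping.lookup F m = 0"
            using lookup_dehom_drop_var[OF F(2) \<open>mdeg m = 2\<close>, of i] F(3) by (simp add: const_coeff_def)
          moreover have "m' \<notin> Poly_Mapping.keys l" using lp by (auto simp: polys_def j True)
          ultimately show ?thesis by (simp add: in_keys_iff)
        qed
      qed
      then have "Poly_Mapping.lookup (F - Var i * l) m = 0" using lm by (simp add: lookup_minus)
      then show False using m by (simp add: in_keys_iff)
    qed
    moreover have "Poly_Mapping.keys m \<subseteq> V"
    proof -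
      have "m \<in> Poly_Mapping.keys F \<or> m \<in> Poly_Mapping.keys (Var i * l)"
        using m by (auto simp: in_keys_iff lookup_minus)
      moreover have "Var i * l \<in> polys V"
        using i lp polys_mono[of "V - {i}" V] by (intro polys_mult polys_Var) auto
      ultimately show ?thesis using F(1) by (auto simp: polys_def)
    qed
    ultimately show "Poly_Mapping.keys m \<subseteq> V - {i}" by (auto simp: in_keys_iff)
  qed
qed

lemma closed_subscheme_overlap:
  assumes "closed_subscheme V X" "i \<in> V" "j \<in> V" "f \<in> polys V" "form d f"
  shows "(\<exists>n. Var j ^ n * dehom i f \<in> X i) \<longleftrightarrow> (\<exists>n. Var i ^ n * dehom j f \<in> X j)"
  using assms(1)[unfolded closed_subscheme_def, THEN conjunct2] assms(2-) by blast

section \<open>The scheme, its ideal and the centre of projection\<close>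

locale inner_projection_data =
  fixes N :: nat and X :: "'k::field subscheme" and I :: "'k mpol set"
  assumes N: "N \<ge> 1"
    and closed: "closed_subscheme {0..N} X"
    and reduced: "reduced {0..N} X"
    and nondeg: "nondegenerate {0..N} X"
    and def_ideal: "defining_ideal {0..N} X I"
    and point: "mem_scheme {0..N} (coord_point 0) X"
begin

lemma homogeneous_I: "homogeneous_ideal {0..N} I"
  using def_ideal by (simp add: defining_ideal_def)

lemma ideal_I: "ideal_in {0..N} I"
  using homogeneous_I by (simp add: homogeneous_ideal_def)

lemma sheafify_I: "i \<le> N \<Longrightarrow> sheafify I i = X i"
  using def_ideal by (simp add: defining_ideal_def)

lemma dehom_I: "f \<in> I \<Longrightarrow> form d f \<Longrightarrow> i \<le> N \<Longrightarrow> dehom i f \<in> X i"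
  unfolding sheafify_I[symmetric] sheafify_def by blast

lemma minus_0: "{0..N} - {0} = {1..N}"
  by auto

lemma ideal_X0: "ideal_in {1..N} (X 0)"
proof -
  have "ideal_in ({0..N} - {0}) (X 0)" using closed unfolding closed_subscheme_def by simp
  then show ?thesis by (simp only: minus_0)
qed

lemma const_coeff_X0: "f \<in> X 0 \<Longrightarrow> const_coeff f = 0"
proof -
  assume f: "f \<in> X 0"
  have "eval_at (\<lambda>j. coord_point 0 j / coord_point 0 0) f = 0"
  proof -
    have "(coord_point 0 0 :: 'k) \<noteq> 0" by (simp add: coord_point_def)
    then show ?thesis using point f unfolding mem_scheme_def by simp
  qed
  moreover have "eval_at (\<lambda>j. coord_point 0 j / coord_point 0 0) f = const_coeff f"
    using f ideal_inD(1)[OF ideal_X0] by (intro eval_at_origin[of _ "{1..N}"]) (auto simp: coord_point_def)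
  ultimately show ?thesis by simp
qed

text \<open>A nonzero linear form of \<open>I\<close> would cut out a hyperplane containing
  \<open>X\<close>.\<close>

lemma no_form_of_degree_1:
  assumes "l \<in> I" "form 1 l"
  shows "l = 0"
proof (rule ccontr)
  assume "l \<noteq> 0"
  have "ideal_in {0..N} hull {l} \<subseteq> I"
    by (rule hull_minimal[where S = "ideal_in {0..N}"]) (use assms(1) ideal_I in auto)
  then have "sheafify (ideal_in {0..N} hull {l}) i \<subseteq> sheafify I i" for i
    unfolding sheafify_def by blast
  then have "contained_in {0..N} X (hyperplane {0..N} l)"
    unfolding contained_in_def hyperplane_def by (metis atLeastAtMost_iff sheafify_I)
  moreover have "l \<in> polys {0..N}" using assms(1) ideal_inD(1)[OF ideal_I] by blast
  ultimately show False using nondeg assms(2) \<open>l \<noteq> 0\<close> by (auto simp: nondegenerate_def)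
qed

lemma no_form_of_low_degree:
  assumes "f \<in> I" "form d f" "d < 2"
  shows "f = 0"
proof -
  consider "d = 0" | "d = 1" using assms(3) by linarith
  then show ?thesis
  proof cases
    case 1
    \<comment> \<open>A constant in \<open>I\<close> is moved up to degree 1, where the previous
      lemma applies.\<close>
    have "Var 0 * f \<in> I" using assms(1) by (intro ideal_inD(4)[OF ideal_I] polys_Var) auto
    moreover have "form 1 (Var 0 * f)" using form_mult[OF form_Var[of 0] assms(2)] 1 by simp
    ultimately have "Var 0 * f = 0" by (rule no_form_of_degree_1)
    then show ?thesis by (simp add: Var_def single_eq_0_iff)
  next
    case 2
    then show ?thesis using no_form_of_degree_1 assms by blast
  qed
qed

lemma homogeneous_elim_ideal: "homogeneous_ideal {1..N} (elim_ideal N I)"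
proof -
  have "polys {1..N} \<subseteq> polys {0..N}" by (rule polys_mono) auto
  then have "ideal_in {1..N} (elim_ideal N I)"
    unfolding elim_ideal_def
    by (intro ideal_inI) (auto intro: ideal_inD[OF ideal_I] polys_add polys_mult)
  then show ?thesis
    using homogeneous_I by (auto simp: homogeneous_ideal_def elim_ideal_def polys_hcomp)
qed

section \<open>Quadrics and their linear parts at the point\<close>

definition quadrics :: "'k mpol set" where
  "quadrics = {f \<in> I. form 2 f}"

text \<open>For \<open>f = x_0 l + g\<close> this is the set of the \<open>l\<close>. Read as
  coefficients of \<open>x_0\<close> they describe the partial elimination ideal; read as linear
  terms of local equations they describe the tangent space.\<close>

definition linear_parts :: "'k mpol set" where
  "linear_parts = (\<lambda>f. hcomp 1 (dehom 0 f)) ` quadrics"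

lemma betti_I: "betti {0..N} 0 2 I = pm.dim quadrics"
  unfolding quadrics_def
  by (rule betti_0_lowest_degree[OF _ homogeneous_I]) (auto intro: no_form_of_low_degree)

lemma betti_elim_ideal: "betti {1..N} 0 2 (elim_ideal N I) = pm.dim {f \<in> elim_ideal N I. form 2 f}"
  by (rule betti_0_lowest_degree[OF _ homogeneous_elim_ideal])
    (auto simp: elim_ideal_def intro: no_form_of_low_degree)

lemma subspace_quadrics: "pm.subspace quadrics"
  unfolding quadrics_def by (rule subspace_ideal_forms[OF ideal_I])

lemma subspace_linear_parts: "pm.subspace linear_parts"
proof -
  interpret Vector_Spaces.linear pm_scale pm_scale "\<lambda>f :: 'k mpol. hcomp 1 (dehom 0 f)"
    by (rule linear_linear_part)
  show ?thesis unfolding linear_parts_def by (rule subspace_image[OF subspace_quadrics])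
qed

lemma quadrics_decomposition:
  assumes "f \<in> quadrics"
  shows "hcomp 1 (dehom 0 f) \<in> polys {1..N}" "f - Var 0 * hcomp 1 (dehom 0 f) \<in> polys {1..N}"
proof -
  have f: "f \<in> polys {0..N}" "form 2 f" "const_coeff (dehom 0 f) = 0"
    using assms ideal_inD(1)[OF ideal_I] const_coeff_X0 dehom_I by (auto simp: quadrics_def)
  show "hcomp 1 (dehom 0 f) \<in> polys {1..N}" "f - Var 0 * hcomp 1 (dehom 0 f) \<in> polys {1..N}"
    using quadric_decomposition[OF f] unfolding minus_0 by simp_all
qed

lemma dim_quadrics: "pm.dim quadrics = pm.dim {f \<in> elim_ideal N I. form 2 f} + pm.dim linear_parts"
proof -
  interpret vector_space_pair "pm_scale :: 'k \<Rightarrow> 'k mpol \<Rightarrow> _" "pm_scale :: 'k \<Rightarrow> 'k mpol \<Rightarrow> _" ..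
  let ?T = "(\<lambda>m. Poly_Mapping.single m (1::'k)) ` {m. Poly_Mapping.keys m \<subseteq> {0..N} \<and> mdeg m = 2}"
  \<comment> \<open>If \<open>l = 0\<close> then \<open>f = g\<close> is free of \<open>x_0\<close>;
    conversely a quadric free of \<open>x_0\<close> is its own dehomogenization and has no linear
    part.\<close>
  have "{f \<in> quadrics. hcomp 1 (dehom 0 f) = 0} = {f \<in> elim_ideal N I. form 2 f}"
  proof (intro equalityI subsetI)
    fix f assume "f \<in> {f \<in> quadrics. hcomp 1 (dehom 0 f) = 0}"
    then show "f \<in> {f \<in> elim_ideal N I. form 2 f}"
      using quadrics_decomposition(2)[of f] by (auto simp: elim_ideal_def quadrics_def)
  next
    fix f assume f: "f \<in> {f \<in> elim_ideal N I. form 2 f}"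
    then have "dehom 0 f = f" by (intro dehom_id[of _ "{1..N}"]) (auto simp: elim_ideal_def)
    then show "f \<in> {f \<in> quadrics. hcomp 1 (dehom 0 f) = 0}"
      using f hcomp_form[of 2 f 1] by (auto simp: elim_ideal_def quadrics_def)
  qed
  moreover have "quadrics \<subseteq> pm.span ?T"
    using forms_subset_span[of "{0..N}" 2] ideal_inD(1)[OF ideal_I] by (auto simp: quadrics_def)
  ultimately show ?thesis
    using rank_nullity_subspace[OF linear_linear_part[of 0] subspace_quadrics, of ?T]
      finite_monomials[of "{0..N}" 2] by (simp add: linear_parts_def)
qed

text \<open>As \<open>g\<close> is free of \<open>x_0\<close>, the coefficients of \<open>f'\<close>
  are those of the whole form at multiples of \<open>x_0\<close>. Hence the generators of
  \<open>partial_elim_ideal1\<close> are homogeneous, and those from quadrics are linear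
  parts.\<close>

lemma partial_elim_generators:
  assumes f': "f' \<in> polys {1..N}" and g: "g \<in> polys {1..N}"
    and F: "Var 0 * f' + g \<in> I" "form d (Var 0 * f' + g)"
  shows "form (d - 1) f'" "d < 2 \<Longrightarrow> f' = 0" "d = 2 \<Longrightarrow> f' \<in> linear_parts"
proof -
  let ?F = "Var 0 * f' + g"
  have lk: "Poly_Mapping.lookup ?F (Poly_Mapping.single 0 1 + m) = Poly_Mapping.lookup f' m" for m
  proof -
    have "Poly_Mapping.single 0 1 + m \<notin> Poly_Mapping.keys g"
    proof
      assume "Poly_Mapping.single 0 1 + m \<in> Poly_Mapping.keys g"
      moreover have "0 \<in> Poly_Mapping.keys (Poly_Mapping.single 0 1 + m)"
        by (simp add: in_keys_iff lookup_add)
      ultimately have "(0::nat) \<in> {1..N}" using g unfolding polys_def by blast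
      then show False by simp
    qed
    then show ?thesis by (simp add: lookup_add Var_def lookup_single_mult in_keys_iff del: One_nat_def)
  qed
  show form_f': "form (d - 1) f'"
    unfolding form_def
  proof
    fix m assume "m \<in> Poly_Mapping.keys f'"
    then have "Poly_Mapping.single 0 1 + m \<in> Poly_Mapping.keys ?F"
      using lk[of m] by (simp add: in_keys_iff del: One_nat_def)
    then have "mdeg (Poly_Mapping.single 0 1 + m) = d" using F(2) by (auto simp: form_def simp del: One_nat_def)
    then show "mdeg m = d - 1" by (simp add: mdeg_add)
  qed
  show "f' = 0" if "d < 2"
  proof -
    have "?F = 0" using no_form_of_low_degree[OF F that] .
    then show ?thesis using lk by (intro poly_mapping_eqI) (simp del: One_nat_def)
  qed
  show "f' \<in> linear_parts" if "d = 2"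
  proof -
    have "dehom 0 (Var 0 :: 'k mpol) = 1" using dehom_Var_power[of 0 1] by simp
    then have "dehom 0 ?F = f' + g"
      using dehom_id[OF f', of 0] dehom_id[OF g, of 0] by (simp add: dehom_add dehom_mult)
    moreover have "form 2 g"
    proof -
      have "form 2 (Var 0 * f')" using form_mult[OF form_Var[of 0] form_f'] that by (simp add: numeral_2_eq_2)
      then have "form 2 (?F + pm_scale (- 1) (Var 0 * f'))" using F(2) that by (intro form_add[of 2 ?F] form_scale) simp_all
      moreover have "?F + pm_scale (- 1) (Var 0 * f') = g"
        by (rule poly_mapping_eqI) (simp add: lookup_add lookup_pm_scale)
      ultimately show ?thesis by (simp only:)
    qed
    ultimately have "hcomp 1 (dehom 0 ?F) = f'"
      using form_f' that hcomp_form[of 2 g 1] by (simp add: hcomp_add form_iff_hcomp)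
    then show ?thesis using F that by (force simp: linear_parts_def quadrics_def)
  qed
qed

text \<open>By the Leibniz rule \<open>?P\<close> is an ideal. It contains the generators, so the
  partial elimination ideal has no nonzero constants and no linear forms beyond
  \<open>linear_parts\<close>; degree 1 is thus its lowest possible degree.\<close>

lemma betti_partial_elim_ideal: "betti {1..N} 0 1 (partial_elim_ideal1 N I) = pm.dim linear_parts"
proof -
  let ?G = "{f' \<in> polys {1..N}. \<exists>g\<in>polys {1..N}. Var 0 * f' + g \<in> I \<and> (\<exists>d. form d (Var 0 * f' + g))}"
  let ?K = "partial_elim_ideal1 N I"
  have K: "?K = ideal_in {1..N} hull ?G" by (simp add: partial_elim_ideal1_def)
  have hom: "homogeneous_ideal {1..N} ?K"
    unfolding K using partial_elim_generators(1) by (intro homogeneous_ideal_hull) blast+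
  let ?P = "{f \<in> polys {1..N}. const_coeff f = 0 \<and> hcomp 1 f \<in> linear_parts}"
  have "ideal_in {1..N} ?P"
  proof (rule ideal_inI)
    show "0 \<in> ?P" using pm.subspace_0[OF subspace_linear_parts] by simp
    show "f + g \<in> ?P" if "f \<in> ?P" "g \<in> ?P" for f g
      using that pm.subspace_add[OF subspace_linear_parts]
      by (auto simp: polys_add const_coeff_add hcomp_add)
    show "r * f \<in> ?P" if "r \<in> polys {1..N}" "f \<in> ?P" for r f
      using that pm.subspace_scale[OF subspace_linear_parts]
      by (auto simp: polys_mult const_coeff_mult hcomp_1_mult simp del: One_nat_def)
  qed auto
  moreover have "?G \<subseteq> ?P"
  proof
    fix f' assume "f' \<in> ?G"
    then obtain g d where f': "f' \<in> polys {1..N}" and g: "g \<in> polys {1..N}"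
      and F: "Var 0 * f' + g \<in> I" "form d (Var 0 * f' + g)" by blast
    note gen = partial_elim_generators[OF f' g F]
    have z: "0 \<in> linear_parts" using pm.subspace_0[OF subspace_linear_parts] .
    consider "d < 2" | "d = 2" | "d > 2" by linarith
    then show "f' \<in> ?P"
    proof cases
      case 1
      then show ?thesis using gen(2) z by simp
    next
      case 2
      then have "form 1 f'" using gen(1) by simp
      then show ?thesis using 2 f' gen(3) const_coeff_form[of 1 f'] by (simp add: form_iff_hcomp)
    next
      case 3
      \<comment> \<open>Generators from forms of degree above 2 have degree at least 2
        themselves.\<close>
      then have "hcomp 1 f' = 0" using hcomp_form[OF gen(1), of 1] by auto
      then show ?thesis using 3 f' z const_coeff_form[OF gen(1)] by simp
    qed
  qed
  ultimately have KP: "?K \<subseteq> ?P" unfolding K by (intro hull_minimal[where S = "ideal_in {1..N}"])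
  have "{f \<in> ?K. form 1 f} = linear_parts"
  proof (intro equalityI subsetI)
    fix f assume "f \<in> {f \<in> ?K. form 1 f}"
    then have "hcomp 1 f \<in> linear_parts" "hcomp 1 f = f" using KP unfolding form_iff_hcomp by blast+
    then show "f \<in> linear_parts" by simp
  next
    fix l assume "l \<in> linear_parts"
    then obtain F where F: "F \<in> quadrics" "l = hcomp 1 (dehom 0 F)" by (auto simp: linear_parts_def)
    have "Var 0 * l + (F - Var 0 * l) = F" by simp
    then have "l \<in> ?G"
      using F quadrics_decomposition[OF F(1)] by (intro CollectI conjI bexI[of _ "F - Var 0 * l"]) (auto simp: quadrics_def)
    then have "l \<in> ?K" unfolding K by (rule hull_inc)
    then show "l \<in> {f \<in> ?K. form 1 f}" using F(2) form_hcomp by blast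
  qed
  moreover have "betti {1..N} 0 1 ?K = pm.dim {f \<in> ?K. form 1 f}"
  proof (rule betti_0_lowest_degree[OF _ hom])
    fix f d assume "f \<in> ?K" "form d f" "d < 1"
    then have "form 0 f" "const_coeff f = 0" using KP by auto
    then show "f = 0" by (simp add: form_0_iff Const_def)
  qed simp
  ultimately show ?thesis by simp
qed

text \<open>Again by the Leibniz rule \<open>?P\<close> is an ideal. It contains the generating
  quadrics, hence \<open>I\<close>, so equations of higher degree contribute no new linear parts at
  the point.\<close>

lemma dim_tangent_space:
  assumes "quadratic_ideal {0..N} I"
  shows "fn.dim (tangent_space {0..N} X 0 (coord_point 0)) + pm.dim linear_parts = N"
proof -
  obtain G where G: "G \<subseteq> polys {0..N}" "\<And>g. g \<in> G \<Longrightarrow> form 2 g" "I = ideal_in {0..N} hull G"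
    using assms by (auto simp: quadratic_ideal_def)
  let ?P = "{f \<in> polys {0..N}. const_coeff (dehom 0 f) = 0 \<and> hcomp 1 (dehom 0 f) \<in> linear_parts}"
  have "ideal_in {0..N} ?P"
  proof (rule ideal_inI)
    show "0 \<in> ?P" using pm.subspace_0[OF subspace_linear_parts] by simp
    show "f + g \<in> ?P" if "f \<in> ?P" "g \<in> ?P" for f g
      using that pm.subspace_add[OF subspace_linear_parts]
      by (auto simp: polys_add const_coeff_add hcomp_add dehom_add)
    show "r * f \<in> ?P" if "r \<in> polys {0..N}" "f \<in> ?P" for r f
      using that pm.subspace_scale[OF subspace_linear_parts]
      by (auto simp: polys_mult const_coeff_mult hcomp_1_mult dehom_mult simp del: One_nat_def)
  qed auto
  moreover have "G \<subseteq> ?P"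
  proof
    fix g assume g: "g \<in> G"
    then have "g \<in> I" unfolding G(3) by (rule hull_inc)
    then show "g \<in> ?P"
      using g G(1,2) const_coeff_X0 dehom_I[of g 2 0] by (auto simp: linear_parts_def quadrics_def)
  qed
  ultimately have IP: "I \<subseteq> ?P" unfolding G(3) by (intro hull_minimal[where S = "ideal_in {0..N}"])
  have "hcomp 1 ` X 0 = linear_parts"
    using IP unfolding sheafify_I[of 0, OF le0, symmetric] sheafify_def linear_parts_def quadrics_def by auto
  then show ?thesis
    using dim_affine_tangent_space[of "{1..N}" "\<lambda>j. coord_point 0 j / coord_point 0 0" "X 0"]
      ideal_inD(1)[OF ideal_X0] const_coeff_X0 subspace_linear_parts
    by (auto simp: tangent_space_def minus_0 coord_point_def subset_iff)
qed

section \<open>Global sections of the twisted ideal sheaves\<close>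

lemma h0_X:
  assumes "I = saturated_ideal {0..N} X"
  shows "h0 {0..N} X 2 = pm.dim quadrics"
proof (rule h0_eq_dim)
  show "{f \<in> polys {0..N}. form 2 f \<and> (\<forall>i\<in>{0..N}. dehom i f \<in> X i)} = quadrics"
  proof (intro equalityI subsetI)
    fix f assume f: "f \<in> {f \<in> polys {0..N}. form 2 f \<and> (\<forall>i\<in>{0..N}. dehom i f \<in> X i)}"
    have "dehom i (hcomp d f) \<in> X i" if i: "i \<in> {0..N}" for d i
    proof -
      have "0 \<in> X i" using closed i by (auto simp: closed_subscheme_def dest: ideal_inD(2))
      then show ?thesis using f i hcomp_form[of 2 f d] by simp
    qed
    then show "f \<in> quadrics" using f unfolding quadrics_def by (simp add: assms saturated_ideal_def)
  next
    fix f assume "f \<in> quadrics"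
    then show "f \<in> {f \<in> polys {0..N}. form 2 f \<and> (\<forall>i\<in>{0..N}. dehom i f \<in> X i)}"
      using dehom_I[of f 2] ideal_inD(1)[OF ideal_I] by (auto simp: quadrics_def)
  qed
qed (auto simp: subspace_quadrics)

text \<open>Only the chart 0 contains the point. Away from it \<open>f\<close> vanishes on
  \<open>X\<close>, so some \<open>x_i^n * f\<close> lies in \<open>X 0\<close>; reducedness brings
  this down to \<open>x_i * f\<close>. Positive degree makes \<open>f^2\<close> a combination of
  these products, and reducedness applies once more.\<close>

lemma mem_X0_if_mem_other_charts:
  assumes f: "f \<in> polys {1..N}" "form d f" "d > 0" and ch: "\<And>i. i \<in> {1..N} \<Longrightarrow> dehom i f \<in> X i"
  shows "f \<in> X 0"
proof -
  have rad: "h \<in> X 0" if "h \<in> polys {1..N}" "h ^ n \<in> X 0" for h n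
  proof -
    have "radical_ideal ({0..N} - {0}) (X 0)" using reduced unfolding reduced_def by simp
    then show ?thesis using that unfolding minus_0 radical_ideal_def by blast
  qed
  have fV: "f \<in> polys {0..N}" using f(1) polys_mono[of "{1..N}" "{0..N}"] by auto
  have Vf: "Var i * f \<in> X 0" if i: "i \<in> {1..N}" for i
  proof -
    have "(\<exists>n. Var 0 ^ n * dehom i f \<in> X i) \<longleftrightarrow> (\<exists>n. Var i ^ n * dehom 0 f \<in> X 0)"
      using i by (intro closed_subscheme_overlap[OF closed _ _ fV f(2)]) auto
    moreover have "Var 0 ^ 0 * dehom i f \<in> X i" using ch[OF i] by simp
    ultimately have "\<exists>n. Var i ^ n * dehom 0 f \<in> X 0" by blast
    then obtain n where "Var i ^ n * f \<in> X 0" using dehom_id[OF f(1), of 0] by auto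
    \<comment> \<open>This multiplier completes \<open>x_i^n * f\<close> to a power of
      \<open>x_i * f\<close>.\<close>
    moreover have "Var i * f ^ n \<in> polys {1..N}"
      using i by (intro polys_mult polys_Var polys_power f(1))
    ultimately have "(Var i * f ^ n) * (Var i ^ n * f) \<in> X 0" by (rule ideal_inD(4)[OF ideal_X0, rotated])
    also have "(Var i * f ^ n) * (Var i ^ n * f) = (Var i * f) ^ Suc n"
      by (simp add: power_mult_distrib mult_ac)
    finally show ?thesis by (rule rad[rotated]) (use i f(1) in \<open>intro polys_mult polys_Var\<close>)
  qed
  \<comment> \<open>Each monomial of \<open>f\<close> contains some \<open>x_i\<close>, so each term
    of \<open>f\<close> times \<open>f\<close> is a multiple of \<open>x_i * f\<close>.\<close>
  have "Poly_Mapping.single m c * f \<in> X 0" if m: "m \<in> Poly_Mapping.keys f" for m c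
  proof -
    have "mdeg m \<noteq> 0" using m f(2,3) by (auto simp: form_def)
    then have "m \<noteq> 0" by auto
    then obtain i where i: "i \<in> Poly_Mapping.keys m" using keys_nonempty by blast
    have mV: "Poly_Mapping.keys m \<subseteq> {1..N}" using m f(1) by (auto simp: polys_def)
    let ?r = "m - Poly_Mapping.single i 1"
    have "Poly_Mapping.single m c = Poly_Mapping.single ?r c * Var i"
      using exponent_split[of 1 m i] i by (simp add: Var_def mult_single in_keys_iff Suc_le_eq add.commute)
    moreover have "Poly_Mapping.single ?r c \<in> polys {1..N}"
      using mV by (intro polys_single) (auto simp: in_keys_iff lookup_minus)
    moreover have "Var i * f \<in> X 0" using Vf i mV by blast
    ultimately show ?thesis
      by (simp only: mult.assoc ideal_inD(4)[OF ideal_X0])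
  qed
  then have "(\<Sum>m\<in>Poly_Mapping.keys f. Poly_Mapping.single m (Poly_Mapping.lookup f m) * f) \<in> X 0"
    by (rule ideal_in_sum[OF ideal_X0])
  then have "f ^ 2 \<in> X 0"
    by (simp add: power2_eq_square flip: sum_distrib_right poly_mapping_sum_singles)
  then show ?thesis by (rule rad[OF f(1)])
qed

text \<open>On the charts of the smaller projective space the equations of the projection are those
  of \<open>X\<close> free of \<open>x_0\<close>. A quadric section thus satisfies the equations on
  all charts other than 0, then on chart 0 by \<open>mem_X0_if_mem_other_charts\<close>, and
  saturation puts it into \<open>I\<close>.\<close>

lemma h0_inner_projection:
  assumes "I = saturated_ideal {0..N} X"
  shows "h0 {1..N} (inner_projection N I) 2 = pm.dim {f \<in> elim_ideal N I. form 2 f}"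
proof (rule h0_eq_dim)
  show "{f \<in> polys {1..N}. form 2 f \<and> (\<forall>i\<in>{1..N}. dehom i f \<in> inner_projection N I i)} =
      {f \<in> elim_ideal N I. form 2 f}"
  proof (intro equalityI subsetI)
    fix f assume f: "f \<in> {f \<in> polys {1..N}. form 2 f \<and> (\<forall>i\<in>{1..N}. dehom i f \<in> inner_projection N I i)}"
    have ch: "dehom i f \<in> X i" if "i \<in> {1..N}" for i
      using f that inner_projection_eq_closure[OF def_ideal that] by (auto simp: projection_closure_def)
    have f0: "f \<in> X 0" using mem_X0_if_mem_other_charts[of f 2] f ch by auto
    have "dehom i f \<in> X i" if "i \<in> {0..N}" for i
      using ch[of i] f f0 that dehom_id[of f "{1..N}" 0] by (cases "i = 0") auto
    moreover have "0 \<in> X i" if "i \<in> {0..N}" for i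
      using closed that by (auto simp: closed_subscheme_def dest: ideal_inD(2))
    ultimately have "dehom i (hcomp d f) \<in> X i" if "i \<in> {0..N}" for d i
      using f that hcomp_form[of 2 f d] by simp
    moreover have "f \<in> polys {0..N}" using f polys_mono[of "{1..N}" "{0..N}"] by auto
    ultimately show "f \<in> {f \<in> elim_ideal N I. form 2 f}"
      using f by (simp add: elim_ideal_def assms saturated_ideal_def)
  next
    fix f assume "f \<in> {f \<in> elim_ideal N I. form 2 f}"
    then show "f \<in> {f \<in> polys {1..N}. form 2 f \<and> (\<forall>i\<in>{1..N}. dehom i f \<in> inner_projection N I i)}"
      by (auto simp: elim_ideal_def inner_projection_def sheafify_def)
  qed
  show "pm.subspace {f \<in> elim_ideal N I. form 2 f}"
    using homogeneous_elim_ideal unfolding homogeneous_ideal_def by (blast intro: subspace_ideal_forms)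
qed (use N in auto)

end

theorem proposition3p6:
  fixes N :: nat
    and X :: "'k::{alg_closed_field, field_char_0} subscheme"
    and I :: "'k mpol set"
  assumes "N \<ge> 1"
    and "closed_subscheme {0..N} X"
    and "reduced {0..N} X"
    and "nondegenerate {0..N} X"
    and "defining_ideal {0..N} X I"
    and "mem_scheme {0..N} (coord_point 0) X"
  shows "int (betti {1..N} 0 2 (elim_ideal N I)) =
      int (betti {0..N} 0 2 I) - int (betti {1..N} 0 1 (partial_elim_ideal1 N I)) \<and>
    (quadratic_ideal {0..N} I \<longrightarrow>
      int (betti {1..N} 0 2 (elim_ideal N I)) =
        int (betti {0..N} 0 2 I) - int N
          + int (fn.dim (tangent_space {0..N} X 0 (coord_point 0)))) \<and>
    (quadratic_ideal {0..N} I \<and> I = saturated_ideal {0..N} X \<longrightarrow>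
      int (h0 {1..N} (inner_projection N I) 2) =
        int (h0 {0..N} X 2) - int N
          + int (fn.dim (tangent_space {0..N} X 0 (coord_point 0))))"
proof -
  interpret inner_projection_data N X I
    using assms by unfold_locales
  have a: "int N = int (fn.dim (tangent_space {0..N} X 0 (coord_point 0))) + int (pm.dim linear_parts)"
    if "quadratic_ideal {0..N} I"
    using dim_tangent_space[OF that] by linarith
  have b: "int (h0 {1..N} (inner_projection N I) 2) = int (h0 {0..N} X 2) - int (pm.dim linear_parts)"
    if "I = saturated_ideal {0..N} X"
    unfolding h0_X[OF that] h0_inner_projection[OF that] dim_quadrics by simp
  show ?thesis
    \<comment> \<open>Part (a) becomes the rank-nullity identity for quadrics; the other parts
      replace the dimension of \<open>linear_parts\<close> by the codimension of the tangent
      space.\<close>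
    unfolding betti_I betti_elim_ideal betti_partial_elim_ideal dim_quadrics
  proof (intro conjI impI)
    assume "quadratic_ideal {0..N} I \<and> I = saturated_ideal {0..N} X"
    then show "int (h0 {1..N} (inner_projection N I) 2) = int (h0 {0..N} X 2) - int N
        + int (fn.dim (tangent_space {0..N} X 0 (coord_point 0)))"
      using a b by (elim conjE) linarith
  qed (use a in simp_all)
qed

end
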